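(* Assume $n_1=\cdots=n_m=n$ with $m\ge2$. There exists a universal constant $c_L>0$ such that (for all $m\ge2$, $d,n,n_0\ge1$ and $\tau>0$ with $d\tau^2/n_0\le1$) $$\mathfrak C^\star([0,1]^m)\;\ge\;c_L\max\left[\left\{\frac{n_0+mn}{d}\left(\frac{d}{n_0}\wedge\frac1n\sqrt{\frac dm}\right)\right\},\ \frac{n_0+mn}{d\,n_0}\right].$$
   Context: There are $m+1$ domains ($k=0$ target, $k=1,\dots,m$ sources), with parameters $\theta_0^\star,\dots,\theta_m^\star\in\mathbb R^d$, sample sizes $\boldsymbol n=(n_0,\dots,n_m)$ and local estimators $\widetilde\theta_0,\dots,\widetilde\theta_m$. A constant $C_\tau>0$ is fixed throughout and suppressed from notation. For $\boldsymbol h\in[0,1]^m$, $\mathcal P(\boldsymbol h,\boldsymbol n,\tau)$ is the set of joint distributions of $(\widetilde\theta_0,\dots,\widetilde\theta_m)$ such that the $\widetilde\theta_k$ are independent and there exist $\theta_0^\star,\dots,\theta_m^\star\in\mathbb R^d$ with $\|\theta_k^\star-\theta_0^\star\|_2\le h_k$ for $k=1,\dots,m$ and $\max_{\|a\|_2=1}P(a^\top(\widetilde\theta_k-\theta_k^\star)>t)\le C_\tau\exp(-n_kt^2/(2\tau^2))$ for all $t>0$ and $k=0,\dots,m$. Oracle rate: with $h_0:=0$, $\mathfrak R(\boldsymbol h,\boldsymbol n,\tau):=\min_{\{0\}\subset S\subset\{0,\dots,m\}}\{d\tau^2/\sum_{k\in S}n_k+\max_{k\in S}h_k^2\}$. For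 $\mathcal H\subset[0,1]^m$ and an estimator $\widehat\theta_0$ depending on $\{\widetilde\theta_k\}_{k=0}^m$, $\boldsymbol n$, $\tau$ but not on $\boldsymbol h$, the adaptation cost is $\mathfrak C(\widehat\theta_0,\mathcal H):=\sup_{\boldsymbol h\in\mathcal H}\dfrac{\sup_{P\in\mathcal P(\boldsymbol h,\boldsymbol n,\tau)}\mathbb E_P[\|\widehat\theta_0-\theta_0^\star\|_2^2]}{\mathfrak R(\boldsymbol h,\boldsymbol n,\tau)}$, and the intrinsic cost of adaptation is $\mathfrak C^\star(\mathcal H):=\inf_{\widehat\theta_0}\mathfrak C(\widehat\theta_0,\mathcal H)$ over all such estimators. $a\wedge b=\min(a,b)$.
   Formalization: The fixed constant C_τ is assumed to be at least 1/2 rather than merely positive; for any C_τ<1/2 each local estimator is exact with positive probability and the bound fails (e.g. n_0=nd², m=d³, d large). c_L does not depend on C_τ. *)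

theory Defs
  imports "HOL-Probability.Probability"
begin

text \<open>
  The dimension \<open>d\<close> and the number of sources \<open>m\<close> are quantified under the universal constant, so
  they cannot be types: a point of \<open>d\<close>-space is an extensional function on \<open>{..<d}\<close>, its Euclidean
  norm is \<^term>\<open>L2_set x {..<d}\<close>, and a family of \<open>m + 1\<close> such points (local estimators, or
  parameters) is an extensional function on \<open>{0..m}\<close>, where \<open>0\<close> is the target.
\<close>

definition vec_space :: "nat \<Rightarrow> (nat \<Rightarrow> real) measure" where
  "vec_space d = PiM {..<d} (\<lambda>_. borel)"

definition obs_space :: "nat \<Rightarrow> nat \<Rightarrow> (nat \<Rightarrow> nat \<Rightarrow> real) measure" where
  "obs_space d m = PiM {0..m} (\<lambda>_. vec_space d)"

text \<open>
  The condition defining the class does not determine the parameters from the joint distribution,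
  so an element of the class is a joint distribution \<open>P\<close> paired with parameters \<open>\<theta>\<close> witnessing its
  membership.  The bound on the maximum over unit vectors is stated for every unit vector \<open>a\<close>.
\<close>

definition model_class ::
  "real \<Rightarrow> nat \<Rightarrow> nat \<Rightarrow> (nat \<Rightarrow> real) \<Rightarrow> (nat \<Rightarrow> nat) \<Rightarrow> real
    \<Rightarrow> ((nat \<Rightarrow> nat \<Rightarrow> real) measure \<times> (nat \<Rightarrow> nat \<Rightarrow> real)) set" where
  "model_class C d m h ns \<tau> = {(P, \<theta>).
     prob_space P \<and> sets P = sets (obs_space d m) \<and>
     prob_space.indep_vars P (\<lambda>_. vec_space d) (\<lambda>k \<omega>. \<omega> k) {0..m} \<and>
     \<theta> \<in> space (obs_space d m) \<and>
     (\<forall>k\<in>{1..m}. L2_set (\<lambda>j. \<theta> k j - \<theta> 0 j) {..<d} \<le> h k) \<and>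
     (\<forall>k\<in>{0..m}. \<forall>a. L2_set a {..<d} = 1 \<longrightarrow> (\<forall>t>0.
        measure P {\<omega> \<in> space P. (\<Sum>j<d. a j * (\<omega> k j - \<theta> k j)) > t}
          \<le> C * exp (- (real (ns k) * t\<^sup>2 / (2 * \<tau>\<^sup>2)))))}"

definition oracle_rate :: "nat \<Rightarrow> nat \<Rightarrow> (nat \<Rightarrow> real) \<Rightarrow> (nat \<Rightarrow> nat) \<Rightarrow> real \<Rightarrow> real" where
  "oracle_rate d m h ns \<tau> =
     Min ((\<lambda>S. real d * \<tau>\<^sup>2 / (\<Sum>k\<in>S. real (ns k)) + Max ((\<lambda>k. ((h(0 := 0)) k)\<^sup>2) ` S))
          ` {S. {0} \<subseteq> S \<and> S \<subseteq> {0..m}})"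

text \<open>Expected squared errors may be infinite, hence all risks and costs live in \<^typ>\<open>ennreal\<close>.\<close>

definition sq_risk ::
  "nat \<Rightarrow> ((nat \<Rightarrow> nat \<Rightarrow> real) \<Rightarrow> nat \<Rightarrow> real) \<Rightarrow> (nat \<Rightarrow> nat \<Rightarrow> real) measure
    \<Rightarrow> (nat \<Rightarrow> nat \<Rightarrow> real) \<Rightarrow> ennreal" where
  "sq_risk d est P \<theta> = (\<integral>\<^sup>+ \<omega>. ennreal ((L2_set (\<lambda>j. est \<omega> j - \<theta> 0 j) {..<d})\<^sup>2) \<partial>P)"

definition adaptation_cost ::
  "real \<Rightarrow> nat \<Rightarrow> nat \<Rightarrow> (nat \<Rightarrow> nat) \<Rightarrow> real \<Rightarrow> ((nat \<Rightarrow> nat \<Rightarrow> real) \<Rightarrow> nat \<Rightarrow> real)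
    \<Rightarrow> (nat \<Rightarrow> real) set \<Rightarrow> ennreal" where
  "adaptation_cost C d m ns \<tau> est H =
     (SUP h\<in>H. (SUP (P, \<theta>)\<in>model_class C d m h ns \<tau>. sq_risk d est P \<theta>)
                / ennreal (oracle_rate d m h ns \<tau>))"

text \<open>
  The infimum is taken with \<open>ns\<close> and \<open>\<tau>\<close> fixed but outside the supremum over \<open>h\<close>: the estimator
  may depend on the former and not on the latter.
\<close>

definition intrinsic_cost ::
  "real \<Rightarrow> nat \<Rightarrow> nat \<Rightarrow> (nat \<Rightarrow> nat) \<Rightarrow> real \<Rightarrow> (nat \<Rightarrow> real) set \<Rightarrow> ennreal" where
  "intrinsic_cost C d m ns \<tau> H =
     (INF est\<in>measurable (obs_space d m) (vec_space d). adaptation_cost C d m ns \<tau> est H)"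

end

theory Submission
  imports Defs
begin

text \<open>
  An estimator that does not know \<open>h\<close> does not know which sources share the parameter of the target.
  All lower bounds below exploit this with Gaussian local estimators, whose tails meet the constraint
  of the class already with constant \<open>1/2\<close> (\<open>normal_vec_tail\<close>).  Let \<open>\<epsilon>\<close> be the size of one
  coordinate of the parameters.  If a set \<open>S\<close> of sources is unbiased, the oracle that is told \<open>S\<close>
  achieves \<open>d * \<tau>\<^sup>2 / (n\<^sub>0 + card S * n)\<close>, so a risk \<open>r\<close> forces a cost of at least
  \<open>r * (n\<^sub>0 + card S * n) / (d * \<tau>\<^sup>2)\<close> (\<open>adaptation_cost_ge_clean_risk\<close>).  It remains to make the
  risk large while \<open>S\<close> contains a fixed fraction of the sources.

  \<^bold>\<open>The term with the minimum.\<close>  Draw \<open>v\<close> uniformly from \<open>{\<epsilon>, -\<epsilon>}\<^sup>d\<close>, centre the target at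
  \<open>v\<close>, and centre every source at \<open>v\<close> or at \<open>- v\<close> according to an independent fair label; the
  sources with label \<open>1\<close> are the unbiased ones.  Averaged over the labels, a source has the density
  of an equal mixture of \<open>N(v, \<sigma>\<^sup>2)\<close> and \<open>N(- v, \<sigma>\<^sup>2)\<close>.  Such a mixture does not change when \<open>v\<close>
  changes sign, so to first order it carries no information about a single coordinate: flipping
  one coordinate of \<open>v\<close> lowers the Hellinger affinity of one source from \<open>1\<close> by at most
  \<open>d * \<epsilon>\<^sup>4 / \<sigma>\<^sup>4\<close> (\<open>affinity_symmetrized_flip\<close>), whereas a source with known label loses order
  \<open>\<epsilon>\<^sup>2 / \<sigma>\<^sup>2\<close>.  With \<open>\<sigma>\<^sup>2 = \<tau>\<^sup>2 / n\<close>, all \<open>m\<close> sources together say little about the coordinate as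
  long as \<open>\<epsilon>\<^sup>2\<close> is a small multiple of \<open>\<tau>\<^sup>2 / (n * sqrt (d * m))\<close>, and the target says little as
  long as \<open>\<epsilon>\<^sup>2\<close> is a small multiple of \<open>\<tau>\<^sup>2 / n\<^sub>0\<close>.  The cube argument of Assouad then gives a risk
  of order \<open>d * \<epsilon>\<^sup>2\<close> (\<open>assouad_sign_mixture\<close>).

  The weight \<open>n\<^sub>0 + card S * n\<close> depends on the labels.  It is linear in the indicators of the
  events that source \<open>k\<close> has label \<open>1\<close>, so the weighted average of the risk splits into averages in
  which one single label is known to be \<open>1\<close>.  Each of them obeys the same bound, because one known
  source is as harmless as one more target (\<open>adaptation_cost_ge_hidden_labels\<close>).

  \<^bold>\<open>The other term.\<close>  Put half of the sources at \<open>\<epsilon>\<close> and half at \<open>- \<epsilon>\<close> on the first axis, with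
  \<open>\<epsilon>\<close> of order \<open>\<tau> / sqrt n\<^sub>0\<close>.  Whether the target is at \<open>\<epsilon>\<close> or at \<open>- \<epsilon>\<close>, the sources have the
  same law and a third of them or more is unbiased, but only the target estimator tells the two cases
  apart, and it does not tell them reliably (\<open>adaptation_cost_ge_ambiguous_cluster\<close>).
\<close>

section \<open>Product measures\<close>

lemma density_PiM:
  fixes f :: "'i \<Rightarrow> 'a \<Rightarrow> ennreal"
  assumes I: "finite I" and M: "\<And>i. sigma_finite_measure (M i)"
    and f[measurable]: "\<And>i. f i \<in> borel_measurable (M i)"
    and P: "\<And>i. prob_space (density (M i) (f i))"
  shows "PiM I (\<lambda>i. density (M i) (f i)) = density (PiM I M) (\<lambda>x. \<Prod>i\<in>I. f i (x i))"
proof -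
  interpret M: product_sigma_finite M using M by (simp add: product_sigma_finite_def)
  interpret D: product_sigma_finite "\<lambda>i. density (M i) (f i)"
    unfolding product_sigma_finite_def by (intro allI prob_space_imp_sigma_finite P)
  show ?thesis
  proof (rule D.PiM_eqI[OF I, symmetric])
    show "sets (density (PiM I M) (\<lambda>x. \<Prod>i\<in>I. f i (x i))) = PiM I (\<lambda>i. density (M i) (f i))"
      by (simp cong: sets_PiM_cong)
  next
    fix A assume "\<And>i. i \<in> I \<Longrightarrow> A i \<in> sets (density (M i) (f i))"
    then have A: "\<And>i. i \<in> I \<Longrightarrow> A i \<in> sets (M i)" by simp
    note A[measurable]
    have sets: "Pi\<^sub>E I A \<in> sets (PiM I M)" using I A by (rule sets_PiM_I_finite)
    have "emeasure (density (PiM I M) (\<lambda>x. \<Prod>i\<in>I. f i (x i))) (Pi\<^sub>E I A)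
       = (\<integral>\<^sup>+x. (\<Prod>i\<in>I. f i (x i)) * indicator (Pi\<^sub>E I A) x \<partial>PiM I M)"
      by (rule emeasure_density) (use sets in auto)
    also have "\<dots> = (\<integral>\<^sup>+x. (\<Prod>i\<in>I. f i (x i) * indicator (A i) (x i)) \<partial>PiM I M)"
    proof (rule nn_integral_cong)
      fix x assume "x \<in> space (PiM I M)"
      then have "indicator (Pi\<^sub>E I A) x = (\<Prod>i\<in>I. indicator (A i) (x i) :: ennreal)"
        using I by (auto simp: indicator_def space_PiM PiE_iff)
      then show "(\<Prod>i\<in>I. f i (x i)) * indicator (Pi\<^sub>E I A) x = (\<Prod>i\<in>I. f i (x i) * indicator (A i) (x i))"
        by (simp add: prod.distrib)
    qed
    also have "\<dots> = (\<Prod>i\<in>I. \<integral>\<^sup>+x. f i x * indicator (A i) x \<partial>M i)"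
      by (rule M.product_nn_integral_prod[OF I]) (use A in measurable)
    also have "\<dots> = (\<Prod>i\<in>I. emeasure (density (M i) (f i)) (A i))"
      using A by (intro prod.cong) (auto simp: emeasure_density)
    finally show "emeasure (density (PiM I M) (\<lambda>x. \<Prod>i\<in>I. f i (x i))) (Pi\<^sub>E I A)
       = (\<Prod>i\<in>I. emeasure (density (M i) (f i)) (A i))" .
  qed
qed

lemma indep_vars_PiM_coordinates:
  assumes I: "I \<noteq> {}" and M: "\<And>i. i \<in> I \<Longrightarrow> prob_space (M i)"
  shows "prob_space.indep_vars (PiM I M) M (\<lambda>i x. x i) I"
proof -
  interpret P: prob_space "PiM I M" using M by (rule prob_space_PiM)
  have "distr (PiM I M) (PiM I M) (\<lambda>x. \<lambda>i\<in>I. x i) = PiM I M"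
    by (subst distr_cong[where g = "\<lambda>x. x" and L = "PiM I M" and N = "PiM I M"])
       (auto simp: space_PiM PiE_def extensional_restrict)
  also have "\<dots> = PiM I (\<lambda>i. distr (PiM I M) (M i) (\<lambda>x. x i))"
    by (intro PiM_cong) (auto simp: distr_PiM_component M)
  finally show ?thesis
    by (subst P.indep_vars_iff_distr_eq_PiM'[OF I]) auto
qed

section \<open>Overlap and Hellinger affinity\<close>

text \<open>Weierstrass' inequality, by which affinity deficits of the factors of a product add up.\<close>
lemma prod_one_minus_ge:
  fixes \<delta> :: "'i \<Rightarrow> real"
  assumes "finite I" "\<And>i. i \<in> I \<Longrightarrow> 0 \<le> \<delta> i \<and> \<delta> i \<le> 1"
  shows "1 - sum \<delta> I \<le> (\<Prod>i\<in>I. 1 - \<delta> i)"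
  using assms
proof (induction I)
  case (insert i I)
  have p: "(\<Prod>i\<in>I. 1 - \<delta> i) \<le> 1" using insert.prems by (intro prod_le_1) auto
  have "\<delta> i * (\<Prod>i\<in>I. 1 - \<delta> i) \<le> \<delta> i" using p insert.prems[of i] by (simp add: mult_left_le)
  then show ?case using insert by (simp add: algebra_simps)
qed simp

lemma sqrt_prod: "sqrt (\<Prod>i\<in>I. f i) = (\<Prod>i\<in>I. sqrt (f i))"
  by (induction I rule: infinite_finite_induct) (auto simp: real_sqrt_mult)

text \<open>
  This replaces the inequality of Cauchy and Schwarz in bounding the overlap of two densities by
  their affinity: it is the arithmetic-geometric mean inequality for four times the smaller and a
  quarter of the larger number, and it can be integrated termwise.
\<close>
lemma sqrt_mult_le_min:
  fixes p q :: real assumes "0 \<le> p" "0 \<le> q"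
  shows "sqrt (p * q) \<le> 2 * min p q + (1/8 * p + 1/8 * q)"
proof -
  have *: "sqrt (a * b) \<le> 2 * a + b / 8" if "0 \<le> a" "0 \<le> b" for a b :: real
    using arith_geo_mean_sqrt[of "4 * a" "b / 4"] that by simp
  show ?thesis
  proof (cases "p \<le> q")
    case True
    then show ?thesis using *[of p q] assms by (simp add: min_def)
  next
    case False
    then show ?thesis using *[of q p] assms by (simp add: min_def mult.commute)
  qed
qed

lemma overlap_of_affinity:
  assumes [measurable]: "p \<in> borel_measurable M" "q \<in> borel_measurable M"
    and nonneg: "\<And>x. 0 \<le> p x" "\<And>x. 0 \<le> (q x :: real)"
    and mass: "(\<integral>\<^sup>+x. ennreal (p x) \<partial>M) = 1" "(\<integral>\<^sup>+x. ennreal (q x) \<partial>M) = 1"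
    and aff: "ennreal (1/2) \<le> (\<integral>\<^sup>+x. ennreal (sqrt (p x * q x)) \<partial>M)"
  shows "ennreal (1/8) \<le> (\<integral>\<^sup>+x. ennreal (min (p x) (q x)) \<partial>M)"
proof -
  let ?X = "\<integral>\<^sup>+x. ennreal (min (p x) (q x)) \<partial>M"
  have "(\<integral>\<^sup>+x. ennreal (sqrt (p x * q x)) \<partial>M)
      \<le> (\<integral>\<^sup>+x. 2 * ennreal (min (p x) (q x)) + (ennreal (1/8) * ennreal (p x) + ennreal (1/8) * ennreal (q x)) \<partial>M)"
  proof (rule nn_integral_mono)
    fix x
    have "ennreal (sqrt (p x * q x)) \<le> ennreal (2 * min (p x) (q x) + (1/8 * p x + 1/8 * q x))"
      using sqrt_mult_le_min[OF nonneg, of x x] by (intro ennreal_leI)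
    also have "\<dots> = 2 * ennreal (min (p x) (q x)) + (ennreal (1/8) * ennreal (p x) + ennreal (1/8) * ennreal (q x))"
      using nonneg[of x] by (simp add: ennreal_plus[symmetric] ennreal_mult[symmetric] ennreal_numeral[symmetric] del: ennreal_plus ennreal_numeral)
    finally show "ennreal (sqrt (p x * q x)) \<le> \<dots>" .
  qed
  also have "\<dots> = 2 * ?X + (ennreal (1/8) + ennreal (1/8))"
    by (simp add: nn_integral_add nn_integral_cmult mass)
  finally have le: "ennreal (1/2) \<le> 2 * ?X + (ennreal (1/8) + ennreal (1/8))" using aff by simp
  show ?thesis
  proof (cases ?X)
    case (real r)
    have "2 * ennreal r + (ennreal (1/8) + ennreal (1/8)) = ennreal (2 * r + 1/4)"
      using real(1) by (simp add: ennreal_plus[symmetric] ennreal_mult[symmetric] ennreal_numeral[symmetric] del: ennreal_plus ennreal_numeral)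
    then have "1/2 \<le> 2 * r + 1/4" using le real(2) ennreal_le_iff[of "2 * r + 1/4" "1/2"] real(1) by (simp del: ennreal_plus)
    then show ?thesis using real by (simp add: ennreal_leI)
  qed simp
qed

text \<open>
  The affinity \<open>\<integral> sqrt (p * q)\<close> of two product densities is the product of the affinities of the
  factors.  This is why it is used here in place of the total variation distance: \<open>m\<close> factors with
  deficit of order \<open>1 / m\<close> may each have total variation distance of order \<open>1 / sqrt m\<close>, which could
  not be summed.
\<close>
lemma overlap_product_of_affinities:
  fixes p q :: "'i \<Rightarrow> 'a \<Rightarrow> real"
  assumes I: "finite I" and M: "\<And>i. sigma_finite_measure (M i)"
    and [measurable]: "\<And>i. p i \<in> borel_measurable (M i)" "\<And>i. q i \<in> borel_measurable (M i)"
    and nonneg: "\<And>i x. 0 \<le> p i x" "\<And>i x. 0 \<le> q i x"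
    and mass: "\<And>i. i \<in> I \<Longrightarrow> (\<integral>\<^sup>+x. ennreal (p i x) \<partial>M i) = 1"
              "\<And>i. i \<in> I \<Longrightarrow> (\<integral>\<^sup>+x. ennreal (q i x) \<partial>M i) = 1"
    and aff: "\<And>i. i \<in> I \<Longrightarrow> ennreal (1 - \<delta> i) \<le> (\<integral>\<^sup>+x. ennreal (sqrt (p i x * q i x)) \<partial>M i)"
    and \<delta>: "\<And>i. i \<in> I \<Longrightarrow> 0 \<le> \<delta> i" "sum \<delta> I \<le> 1/2"
  shows "ennreal (1/8) \<le>
    (\<integral>\<^sup>+x. ennreal (min (\<Prod>i\<in>I. p i (x i)) (\<Prod>i\<in>I. q i (x i))) \<partial>PiM I M)"
proof -
  interpret M: product_sigma_finite M using M by (simp add: product_sigma_finite_def)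
  have le1: "\<delta> i \<le> 1" if "i \<in> I" for i
    using member_le_sum[of i I \<delta>] that I \<delta> by fastforce
  have meas: "(\<lambda>x. \<Prod>i\<in>I. r i (x i)) \<in> borel_measurable (PiM I M)"
    if [measurable]: "\<And>i. r i \<in> borel_measurable (M i)" for r :: "'i \<Rightarrow> 'a \<Rightarrow> real"
    by measurable
  have int: "(\<integral>\<^sup>+x. ennreal (\<Prod>i\<in>I. r i (x i)) \<partial>PiM I M) = (\<Prod>i\<in>I. \<integral>\<^sup>+x. ennreal (r i x) \<partial>M i)"
    if [measurable]: "\<And>i. r i \<in> borel_measurable (M i)" and "\<And>i x. 0 \<le> r i x" for r :: "'i \<Rightarrow> 'a \<Rightarrow> real"
    using M.product_nn_integral_prod[OF I, of "\<lambda>i x. ennreal (r i x)"] that by (simp add: prod_ennreal)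
  show ?thesis
  proof (rule overlap_of_affinity)
    have "ennreal (1/2) \<le> ennreal (\<Prod>i\<in>I. 1 - \<delta> i)"
      using prod_one_minus_ge[OF I, of \<delta>] le1 \<delta> by (intro ennreal_leI) fastforce
    also have "\<dots> = (\<Prod>i\<in>I. ennreal (1 - \<delta> i))"
      using le1 by (simp add: prod_ennreal)
    also have "\<dots> \<le> (\<Prod>i\<in>I. \<integral>\<^sup>+x. ennreal (sqrt (p i x * q i x)) \<partial>M i)"
      using I aff by (induction I) (simp_all add: mult_mono)
    also have "\<dots> = (\<integral>\<^sup>+x. ennreal (\<Prod>i\<in>I. sqrt (p i (x i) * q i (x i))) \<partial>PiM I M)"
      by (rule int[symmetric]) (use nonneg in auto)
    also have "\<dots> = (\<integral>\<^sup>+x. ennreal (sqrt ((\<Prod>i\<in>I. p i (x i)) * (\<Prod>i\<in>I. q i (x i)))) \<partial>PiM I M)"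
      by (simp only: prod.distrib[symmetric] sqrt_prod)
    finally show "ennreal (1/2) \<le> \<dots>" .
    show "(\<integral>\<^sup>+x. ennreal (\<Prod>i\<in>I. p i (x i)) \<partial>PiM I M) = 1"
      by (subst int) (use nonneg mass in auto)
    show "(\<integral>\<^sup>+x. ennreal (\<Prod>i\<in>I. q i (x i)) \<partial>PiM I M) = 1"
      by (subst int) (use nonneg mass in auto)
  qed (use nonneg in \<open>simp_all add: meas prod_nonneg\<close>)
qed

text \<open>
  The two-point method: whatever the value of \<open>e\<close>, one of its squared distances to \<open>c\<close> and to
  \<open>- c\<close> is at least \<open>c\<^sup>2\<close>, and on the overlap of the two laws both of them count.
\<close>
lemma two_point_risk:
  fixes p q :: "'i \<Rightarrow> 'a \<Rightarrow> real" and c :: real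
  assumes I: "finite I" and M: "\<And>i. sigma_finite_measure (M i)"
    and [measurable]: "\<And>i. p i \<in> borel_measurable (M i)" "\<And>i. q i \<in> borel_measurable (M i)"
    and nonneg: "\<And>i x. 0 \<le> p i x" "\<And>i x. 0 \<le> q i x"
    and mass: "\<And>i. i \<in> I \<Longrightarrow> (\<integral>\<^sup>+x. ennreal (p i x) \<partial>M i) = 1"
              "\<And>i. i \<in> I \<Longrightarrow> (\<integral>\<^sup>+x. ennreal (q i x) \<partial>M i) = 1"
    and aff: "\<And>i. i \<in> I \<Longrightarrow> ennreal (1 - \<delta> i) \<le> (\<integral>\<^sup>+x. ennreal (sqrt (p i x * q i x)) \<partial>M i)"
    and \<delta>: "\<And>i. i \<in> I \<Longrightarrow> 0 \<le> \<delta> i" "sum \<delta> I \<le> 1/2"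
    and e[measurable]: "e \<in> borel_measurable (PiM I M)"
  shows "ennreal (c\<^sup>2 / 4) \<le>
    (\<integral>\<^sup>+x. ennreal ((e x - c)\<^sup>2) * ennreal (\<Prod>i\<in>I. p i (x i)) \<partial>PiM I M)
    + (\<integral>\<^sup>+x. ennreal ((e x + c)\<^sup>2) * ennreal (\<Prod>i\<in>I. q i (x i)) \<partial>PiM I M)"
proof -
  let ?P = "\<lambda>x. \<Prod>i\<in>I. p i (x i)" and ?Q = "\<lambda>x. \<Prod>i\<in>I. q i (x i)"
  have P: "?P \<in> borel_measurable (PiM I M)" and Q: "?Q \<in> borel_measurable (PiM I M)"
    by measurable
  note [measurable] = P Q
  have "ennreal (c\<^sup>2 / 4) = ennreal (2 * c\<^sup>2) * ennreal (1/8)"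
    by (simp add: ennreal_mult[symmetric])
  also have "\<dots> \<le> ennreal (2 * c\<^sup>2) * (\<integral>\<^sup>+x. ennreal (min (?P x) (?Q x)) \<partial>PiM I M)"
    by (intro mult_left_mono overlap_product_of_affinities[OF I M _ _ nonneg mass aff \<delta>]) auto
  also have "\<dots> = (\<integral>\<^sup>+x. ennreal (2 * c\<^sup>2) * ennreal (min (?P x) (?Q x)) \<partial>PiM I M)"
    by (rule nn_integral_cmult[symmetric]) measurable
  also have "\<dots> \<le> (\<integral>\<^sup>+x. ennreal ((e x - c)\<^sup>2) * ennreal (?P x) + ennreal ((e x + c)\<^sup>2) * ennreal (?Q x) \<partial>PiM I M)"
  proof (rule nn_integral_mono)
    fix x
    have P0: "0 \<le> ?P x" "0 \<le> ?Q x" using nonneg by (auto intro: prod_nonneg)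
    have "2 * c\<^sup>2 * min (?P x) (?Q x) \<le> ((e x - c)\<^sup>2 + (e x + c)\<^sup>2) * min (?P x) (?Q x)"
      using P0 by (intro mult_right_mono) (auto simp: power2_sum power2_diff)
    also have "\<dots> \<le> (e x - c)\<^sup>2 * ?P x + (e x + c)\<^sup>2 * ?Q x"
      unfolding distrib_right by (intro add_mono mult_left_mono) auto
    finally have "ennreal (2 * c\<^sup>2 * min (?P x) (?Q x)) \<le> ennreal ((e x - c)\<^sup>2 * ?P x + (e x + c)\<^sup>2 * ?Q x)"
      by (rule ennreal_leI)
    then show "ennreal (2 * c\<^sup>2) * ennreal (min (?P x) (?Q x))
        \<le> ennreal ((e x - c)\<^sup>2) * ennreal (?P x) + ennreal ((e x + c)\<^sup>2) * ennreal (?Q x)"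
      using P0 by (simp add: ennreal_mult)
  qed
  also have "\<dots> = (\<integral>\<^sup>+x. ennreal ((e x - c)\<^sup>2) * ennreal (?P x) \<partial>PiM I M)
      + (\<integral>\<^sup>+x. ennreal ((e x + c)\<^sup>2) * ennreal (?Q x) \<partial>PiM I M)"
    by (rule nn_integral_add) measurable
  finally show ?thesis .
qed

section \<open>Isotropic Gaussian vectors\<close>

definition normal_vec :: "nat \<Rightarrow> real \<Rightarrow> (nat \<Rightarrow> real) \<Rightarrow> (nat \<Rightarrow> real) measure" where
  "normal_vec d \<sigma> v = PiM {..<d} (\<lambda>j. density lborel (normal_density (v j) \<sigma>))"

definition normal_vec_density :: "nat \<Rightarrow> real \<Rightarrow> (nat \<Rightarrow> real) \<Rightarrow> (nat \<Rightarrow> real) \<Rightarrow> real" where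
  "normal_vec_density d \<sigma> v x = (\<Prod>j<d. normal_density (v j) \<sigma> (x j))"

definition lebesgue_vec :: "nat \<Rightarrow> (nat \<Rightarrow> real) measure" where
  "lebesgue_vec d = PiM {..<d} (\<lambda>_. lborel)"

lemma sets_lebesgue_vec: "sets (lebesgue_vec d) = sets (vec_space d)"
  unfolding lebesgue_vec_def vec_space_def by (intro sets_PiM_cong) auto

lemma sets_normal_vec: "sets (normal_vec d \<sigma> v) = sets (vec_space d)"
  unfolding normal_vec_def vec_space_def by (intro sets_PiM_cong) auto

lemma normal_vec_density_nonneg: "0 \<le> normal_vec_density d \<sigma> v x"
  unfolding normal_vec_density_def by (intro prod_nonneg) auto

lemma borel_measurable_normal_vec_density [measurable]:
  "normal_vec_density d \<sigma> v \<in> borel_measurable (lebesgue_vec d)"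
  unfolding normal_vec_density_def lebesgue_vec_def by measurable

lemma sigma_finite_lebesgue_vec: "sigma_finite_measure (lebesgue_vec d)"
proof -
  interpret finite_product_sigma_finite "\<lambda>_. lborel" "{..<d}" by standard auto
  show ?thesis unfolding lebesgue_vec_def by (rule sigma_finite_measure_axioms)
qed

lemma prob_space_normal_vec: "\<sigma> > 0 \<Longrightarrow> prob_space (normal_vec d \<sigma> v)"
  unfolding normal_vec_def by (intro prob_space_PiM prob_space_normal_density)

lemma normal_vec_eq_density:
  assumes "\<sigma> > 0"
  shows "normal_vec d \<sigma> v = density (lebesgue_vec d) (\<lambda>x. ennreal (normal_vec_density d \<sigma> v x))"
  unfolding normal_vec_def lebesgue_vec_def normal_vec_density_def
  by (subst density_PiM) (auto simp: assms prob_space_normal_density prod_ennreal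
        intro: lborel.sigma_finite_measure_axioms)

lemma nn_integral_normal_vec_density:
  assumes "\<sigma> > 0"
  shows "(\<integral>\<^sup>+x. ennreal (normal_vec_density d \<sigma> v x) \<partial>lebesgue_vec d) = 1"
proof -
  interpret prob_space "density (lebesgue_vec d) (\<lambda>x. ennreal (normal_vec_density d \<sigma> v x))"
    using prob_space_normal_vec[OF assms] by (simp add: normal_vec_eq_density[OF assms])
  have "(\<integral>\<^sup>+x. ennreal (normal_vec_density d \<sigma> v x) \<partial>lebesgue_vec d)
      = (\<integral>\<^sup>+x. 1 \<partial>density (lebesgue_vec d) (\<lambda>x. ennreal (normal_vec_density d \<sigma> v x)))"
    by (subst nn_integral_density) simp_all
  then show ?thesis using emeasure_space_1 by simp
qed

text \<open>
  Shifting the half-line \<open>{t<..}\<close> to \<open>{0<..}\<close> costs the factor \<open>exp (- t\<^sup>2 / (2 * \<sigma>\<^sup>2))\<close> in the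
  density, and by symmetry \<open>{0<..}\<close> has probability at most \<open>1/2\<close>.  The usual Chernoff bound would
  lose the factor \<open>1/2\<close>.
\<close>
lemma normal_tail_half:
  assumes "\<sigma> > 0" "t > 0"
  shows "measure (density lborel (normal_density 0 \<sigma>)) {t<..} \<le> 1/2 * exp (- (t\<^sup>2 / (2 * \<sigma>\<^sup>2)))"
proof -
  let ?N = "density lborel (normal_density 0 \<sigma>)"
  interpret N: prob_space ?N using assms by (intro prob_space_normal_density)
  let ?p = "\<lambda>x. ennreal (normal_density 0 \<sigma> x)"
  have pos: "emeasure ?N {0<..} = (\<integral>\<^sup>+y. ?p y * indicator {0<..} y \<partial>lborel)"
    by (rule emeasure_density) auto
  have "emeasure ?N {0<..} = (\<integral>\<^sup>+y. ?p (0 + (-1) * y) * indicator {0<..} (0 + (-1) * y) \<partial>lborel)"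
    unfolding pos by (subst nn_integral_real_affine[where c = "-1" and t = 0]) auto
  also have "\<dots> = (\<integral>\<^sup>+y. ?p y * indicator {..<0} y \<partial>lborel)"
    by (intro nn_integral_cong) (auto simp: normal_density_def indicator_def)
  also have "\<dots> = emeasure ?N {..<0}"
    by (rule emeasure_density[symmetric]) auto
  finally have "N.prob {0<..} = N.prob {..<0}" by (simp add: measure_def)
  moreover have "N.prob {0<..} + N.prob {..<0} = N.prob ({0<..} \<union> {..<0})"
    by (rule N.finite_measure_Union[symmetric]) auto
  moreover have "N.prob ({0<..} \<union> {..<0}) \<le> 1" by simp
  ultimately have half: "N.prob {0<..} \<le> 1/2" by linarith
  have "emeasure ?N {t<..} = (\<integral>\<^sup>+y. ?p y * indicator {t<..} y \<partial>lborel)"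
    by (rule emeasure_density) auto
  also have "\<dots> = (\<integral>\<^sup>+y. ?p (t + 1 * y) * indicator {t<..} (t + 1 * y) \<partial>lborel)"
    by (subst nn_integral_real_affine[where c = 1 and t = t]) auto
  also have "\<dots> \<le> (\<integral>\<^sup>+y. ennreal (exp (- (t\<^sup>2 / (2 * \<sigma>\<^sup>2)))) * (?p y * indicator {0<..} y) \<partial>lborel)"
  proof (rule nn_integral_mono)
    fix y :: real
    have "normal_density 0 \<sigma> (t + y) \<le> exp (- (t\<^sup>2 / (2 * \<sigma>\<^sup>2))) * normal_density 0 \<sigma> y" if "y > 0"
    proof -
      have "t\<^sup>2 + y\<^sup>2 \<le> (t + y)\<^sup>2" using that assms by (simp add: power2_sum)
      then have "- (t + y)\<^sup>2 / (2 * \<sigma>\<^sup>2) \<le> - (t\<^sup>2 / (2 * \<sigma>\<^sup>2)) + - y\<^sup>2 / (2 * \<sigma>\<^sup>2)"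
        using assms by (simp add: divide_simps)
      then show ?thesis unfolding normal_density_def
        using assms by (simp add: exp_add[symmetric] divide_right_mono)
    qed
    then show "?p (t + 1 * y) * indicator {t<..} (t + 1 * y)
        \<le> ennreal (exp (- (t\<^sup>2 / (2 * \<sigma>\<^sup>2)))) * (?p y * indicator {0<..} y)"
      by (auto simp: indicator_def ennreal_mult[symmetric] intro!: ennreal_leI)
  qed
  also have "\<dots> = ennreal (exp (- (t\<^sup>2 / (2 * \<sigma>\<^sup>2)))) * emeasure ?N {0<..}"
    unfolding pos by (rule nn_integral_cmult) auto
  finally have "N.prob {t<..} \<le> exp (- (t\<^sup>2 / (2 * \<sigma>\<^sup>2))) * N.prob {0<..}"
    by (simp add: N.emeasure_eq_measure ennreal_mult[symmetric])
  also have "\<dots> \<le> exp (- (t\<^sup>2 / (2 * \<sigma>\<^sup>2))) * (1/2)" using half by (intro mult_left_mono) auto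
  finally show ?thesis by simp
qed

lemma distributed_normal_vec_unit_direction:
  assumes \<sigma>: "\<sigma> > 0" and a: "L2_set a {..<d} = 1"
  shows "distributed (normal_vec d \<sigma> v) lborel (\<lambda>x. \<Sum>j<d. a j * (x j - v j)) (normal_density 0 \<sigma>)"
proof -
  interpret P: prob_space "normal_vec d \<sigma> v" using \<sigma> by (rule prob_space_normal_vec)
  let ?N = "\<lambda>j. density lborel (normal_density (v j) \<sigma>)"
  \<comment> \<open>A vanishing coefficient would give a degenerate summand, which has no normal density.\<close>
  define I where "I = {j\<in>{..<d}. a j \<noteq> 0}"
  have a1: "(\<Sum>j<d. (a j)\<^sup>2) = 1" using a by (simp add: L2_set_def real_sqrt_eq_1_iff)
  have sumI: "(\<Sum>j\<in>I. f j) = (\<Sum>j<d. f j)" if "\<And>j. a j = 0 \<Longrightarrow> f j = 0" for f :: "nat \<Rightarrow> real"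
    unfolding I_def using that by (intro sum.mono_neutral_left) auto
  have "I \<noteq> {}"
  proof
    assume "I = {}"
    then have "(\<Sum>j\<in>I. (a j)\<^sup>2) = 0" by simp
    with a1 show False by (simp add: sumI)
  qed
  have "d \<noteq> 0" using a1 by (cases d) auto
  have "P.indep_vars ?N (\<lambda>j x. x j) {..<d}"
    unfolding normal_vec_def
    by (rule indep_vars_PiM_coordinates) (use \<open>d \<noteq> 0\<close> \<sigma> in \<open>auto intro: prob_space_normal_density\<close>)
  then have "P.indep_vars ?N (\<lambda>j x. x j) I"
    by (rule P.indep_vars_subset) (auto simp: I_def)
  then have ind: "P.indep_vars (\<lambda>_. borel) (\<lambda>j x. a j * (x j - v j)) I"
    by (rule P.indep_vars_compose2[where Y = "\<lambda>j y. a j * (y - v j)"]) measurable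
  have dist: "distributed (normal_vec d \<sigma> v) lborel (\<lambda>x. a j * (x j - v j)) (normal_density 0 (\<bar>a j\<bar> * \<sigma>))"
    if j: "j \<in> I" for j
  proof -
    have jd: "j \<in> {..<d}" and aj: "a j \<noteq> 0" using j by (auto simp: I_def)
    have "distr (normal_vec d \<sigma> v) (?N j) (\<lambda>x. x j) = ?N j"
      unfolding normal_vec_def by (rule distr_PiM_component) (use jd \<sigma> in \<open>auto intro: prob_space_normal_density\<close>)
    moreover have "distr (normal_vec d \<sigma> v) (?N j) (\<lambda>x. x j) = distr (normal_vec d \<sigma> v) lborel (\<lambda>x. x j)"
      by (intro distr_cong) auto
    moreover have "(\<lambda>x. x j) \<in> measurable (normal_vec d \<sigma> v) lborel"
      using jd unfolding normal_vec_def by measurable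
    ultimately have "distributed (normal_vec d \<sigma> v) lborel (\<lambda>x. x j) (normal_density (v j) \<sigma>)"
      by (simp add: distributed_def)
    from P.normal_density_affine[OF this \<sigma> aj, of "- a j * v j"]
    show ?thesis by (simp add: algebra_simps)
  qed
  have "distributed (normal_vec d \<sigma> v) lborel (\<lambda>x. \<Sum>j\<in>I. a j * (x j - v j))
      (normal_density (\<Sum>j\<in>I. 0) (sqrt (\<Sum>j\<in>I. (\<bar>a j\<bar> * \<sigma>)\<^sup>2)))"
    by (rule P.sum_indep_normal[OF _ \<open>I \<noteq> {}\<close> ind _ dist]) (use \<sigma> in \<open>auto simp: I_def\<close>)
  moreover have "sqrt (\<Sum>j\<in>I. (\<bar>a j\<bar> * \<sigma>)\<^sup>2) = \<sigma>"
    using \<sigma> a1 sumI[of "\<lambda>j. (a j)\<^sup>2"] by (simp add: power_mult_distrib sum_distrib_right[symmetric])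
  ultimately show ?thesis by (simp add: sumI)
qed

lemma normal_vec_tail:
  assumes \<sigma>: "\<sigma> > 0" and a: "L2_set a {..<d} = 1" and t: "t > 0"
  shows "measure (normal_vec d \<sigma> v) {x \<in> space (normal_vec d \<sigma> v). (\<Sum>j<d. a j * (x j - v j)) > t}
    \<le> 1/2 * exp (- (t\<^sup>2 / (2 * \<sigma>\<^sup>2)))"
proof -
  let ?X = "\<lambda>x. \<Sum>j<d. a j * (x j - v j)"
  note D = distributed_normal_vec_unit_direction[OF \<sigma> a, of v]
  have X: "?X \<in> measurable (normal_vec d \<sigma> v) lborel" using D by (simp add: distributed_def)
  have "measure (normal_vec d \<sigma> v) {x \<in> space (normal_vec d \<sigma> v). ?X x > t}
     = measure (distr (normal_vec d \<sigma> v) lborel ?X) {t<..}"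
    by (subst measure_distr[OF X]) (auto intro!: arg_cong[where f = "measure (normal_vec d \<sigma> v)"])
  also have "distr (normal_vec d \<sigma> v) lborel ?X = density lborel (normal_density 0 \<sigma>)"
    using D by (simp add: distributed_def)
  finally show ?thesis using normal_tail_half[OF \<sigma> t] by simp
qed

section \<open>Symmetrized Gaussian mixtures\<close>

lemma sinh_squared_le: "(sinh a)\<^sup>2 \<le> a * sinh a * cosh (a::real)"
proof -
  have pos: "sinh a \<le> a * cosh a" if "a \<ge> 0" for a :: real
  proof -
    have "(\<lambda>x. x * cosh x - sinh x) 0 \<le> (\<lambda>x. x * cosh x - sinh x) a"
    proof (rule DERIV_nonneg_imp_nondecreasing[OF that])
      fix x :: real assume "0 \<le> x" "x \<le> a"
      then have "((\<lambda>x. x * cosh x - sinh x) has_real_derivative x * sinh x) (at x)" "0 \<le> x * sinh x"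
        by (auto intro!: derivative_eq_intros)
      then show "\<exists>y. ((\<lambda>x. x * cosh x - sinh x) has_real_derivative y) (at x) \<and> 0 \<le> y" by blast
    qed
    then show ?thesis by simp
  qed
  have sq: "(sinh a)\<^sup>2 \<le> a * sinh a * cosh a" if "a \<ge> 0" for a :: real
    using mult_right_mono[OF pos[OF that], of "sinh a"] that by (simp add: power2_eq_square mult_ac)
  show ?thesis using sq[of a] sq[of "-a"] by (cases "a \<ge> 0") auto
qed

text \<open>
  Up to a common factor, \<open>cosh (a + b)\<close> and \<open>cosh (a - b)\<close> are the densities of two symmetrized
  Gaussians whose means differ in the sign of one coordinate.  The product \<open>cosh a * cosh b\<close> is their
  arithmetic mean and \<open>sinh a * sinh b\<close> half their difference \<open>D\<close>.  Their geometric mean falls short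
  of the arithmetic one by at most \<open>D\<^sup>2 / (cosh a * cosh b)\<close>; replacing one factor \<open>D\<close> through
  \<open>\<bar>tanh x\<bar> \<le> \<bar>x\<bar>\<close> leaves a bound that is linear in the densities, so that its integral is a
  Gaussian moment.
\<close>
lemma sqrt_cosh_mult_ge:
  "cosh a * cosh b - a * b * (sinh a * sinh b) \<le> sqrt (cosh (a + b) * cosh (a - b :: real))"
proof -
  define c t u where "c = cosh a * cosh b" and "t = sinh a * sinh b" and "u = a * b * t"
  have c: "c > 0" by (simp add: c_def)
  have eq: "cosh (a + b) * cosh (a - b) = c\<^sup>2 - t\<^sup>2"
    by (simp add: cosh_add cosh_diff c_def t_def power2_eq_square algebra_simps)
  have tc: "t\<^sup>2 \<le> c\<^sup>2" 
    using mult_mono[of "(sinh a)\<^sup>2" "(cosh a)\<^sup>2" "(sinh b)\<^sup>2" "(cosh b)\<^sup>2"]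
    by (simp add: t_def c_def power_mult_distrib cosh_square_eq)
  have "t\<^sup>2 \<le> u * c"
    using mult_mono[OF sinh_squared_le[of a] sinh_squared_le[of b]]
      order_trans[OF zero_le_power2 sinh_squared_le[of a]]
    by (simp add: t_def u_def c_def power_mult_distrib mult_ac)
  show ?thesis
  proof (cases "c - u \<le> 0")
    case True
    then show ?thesis using eq tc unfolding u_def t_def c_def by (smt (verit) real_sqrt_ge_zero)
  next
    case False
    \<comment> \<open>Here \<open>u \<le> c\<close>, and \<open>u\<close> is nonnegative because \<open>t\<^sup>2 \<le> u * c\<close>.\<close>
    have "u * u \<le> u * c" using False \<open>t\<^sup>2 \<le> u * c\<close> c
      by (intro mult_left_mono) (auto simp: zero_le_mult_iff dest: order_trans[OF zero_le_power2])
    then have "(c - u)\<^sup>2 \<le> c\<^sup>2 - t\<^sup>2"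
      using \<open>t\<^sup>2 \<le> u * c\<close> by (simp add: power2_eq_square algebra_simps)
    then have "c - u \<le> sqrt (c\<^sup>2 - t\<^sup>2)" by (rule real_le_rsqrt)
    then show ?thesis by (simp add: eq) (simp add: u_def t_def c_def)
  qed
qed

lemma ennreal_integral_le_nn_integral:
  "ennreal (\<integral>x. f x \<partial>M) \<le> (\<integral>\<^sup>+x. ennreal (f x) \<partial>M)"
proof (cases "integrable M f")
  case True
  have "(\<integral>x. f x \<partial>M) \<le> enn2real (\<integral>\<^sup>+x. ennreal (f x) \<partial>M)"
    using real_lebesgue_integral_def[OF True] by simp
  then have "ennreal (\<integral>x. f x \<partial>M) \<le> ennreal (enn2real (\<integral>\<^sup>+x. ennreal (f x) \<partial>M))" by (rule ennreal_leI)
  also have "\<dots> \<le> (\<integral>\<^sup>+x. ennreal (f x) \<partial>M)"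
    by (cases "\<integral>\<^sup>+x. ennreal (f x) \<partial>M") auto
  finally show ?thesis .
qed (simp add: not_integrable_integral_eq)

text \<open>
  The coordinate \<open>j\<close> is split off because it is the one that will be flipped: the first factor does
  not depend on the mean, and the normalising term is the same for \<open>c\<close> and \<open>- c\<close>.
\<close>
lemma normal_vec_density_upd:
  assumes \<sigma>: "\<sigma> > 0" and j: "j < d"
  shows "normal_vec_density d \<sigma> (v(j := c)) x = normal_vec_density d \<sigma> (\<lambda>_. 0) x *
     exp (((\<Sum>i\<in>{..<d}-{j}. v i * x i) + c * x j) / \<sigma>\<^sup>2 - ((\<Sum>i\<in>{..<d}-{j}. (v i)\<^sup>2) + c\<^sup>2) / (2 * \<sigma>\<^sup>2))"
proof -
  have nd: "normal_density m \<sigma> y = normal_density 0 \<sigma> y * exp (m * y / \<sigma>\<^sup>2 - m\<^sup>2 / (2 * \<sigma>\<^sup>2))" for m y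
  proof -
    have "- (y - m)\<^sup>2 / (2 * \<sigma>\<^sup>2) = - y\<^sup>2 / (2 * \<sigma>\<^sup>2) + (m * y / \<sigma>\<^sup>2 - m\<^sup>2 / (2 * \<sigma>\<^sup>2))"
      using \<sigma> by (simp add: field_simps power2_eq_square)
    then show ?thesis unfolding normal_density_def by (simp only: exp_add mult.assoc diff_zero)
  qed
  have *: "normal_vec_density d \<sigma> w x = normal_vec_density d \<sigma> (\<lambda>_. 0) x *
     exp ((\<Sum>i<d. w i * x i) / \<sigma>\<^sup>2 - (\<Sum>i<d. (w i)\<^sup>2) / (2 * \<sigma>\<^sup>2))" for w
    unfolding normal_vec_density_def
    by (subst nd) (simp add: prod.distrib exp_sum[symmetric] sum_subtractf sum_divide_distrib)
  show ?thesis
    by (subst *) (use j in \<open>simp add: sum.remove[of "{..<d}" j] algebra_simps cong: sum.cong_simp\<close>)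
qed

text \<open>
  The geometric mean of the two Gaussian densities is a multiple of the Gaussian density centred
  half-way, where the flipped coordinate is zero.
\<close>
lemma affinity_normal_vec_flip:
  assumes \<sigma>: "\<sigma> > 0" and j: "j < d"
  shows "(\<integral>\<^sup>+x. ennreal (sqrt (normal_vec_density d \<sigma> v x * normal_vec_density d \<sigma> (v(j := - v j)) x))
      \<partial>lebesgue_vec d) = ennreal (exp (- ((v j)\<^sup>2 / (2 * \<sigma>\<^sup>2))))"
proof -
  let ?p = "normal_vec_density d \<sigma>"
  let ?e = "exp (- ((v j)\<^sup>2 / (2 * \<sigma>\<^sup>2)))"
  have "sqrt (?p v x * ?p (v(j := - v j)) x) = ?e * ?p (v(j := 0)) x" for x
  proof -
    have "?p (v(j := v j)) x * ?p (v(j := - v j)) x = (?e * ?p (v(j := 0)) x)\<^sup>2"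
      unfolding normal_vec_density_upd[OF \<sigma> j] power2_eq_square
      by (simp add: exp_add[symmetric] mult_ac) (simp add: add_divide_distrib diff_divide_distrib exp_add[symmetric] mult.assoc[symmetric] algebra_simps)
    then show ?thesis by (simp add: normal_vec_density_nonneg)
  qed
  then have "(\<integral>\<^sup>+x. ennreal (sqrt (?p v x * ?p (v(j := - v j)) x)) \<partial>lebesgue_vec d)
      = (\<integral>\<^sup>+x. ennreal ?e * ennreal (?p (v(j := 0)) x) \<partial>lebesgue_vec d)"
    by (simp add: ennreal_mult normal_vec_density_nonneg)
  also have "\<dots> = ennreal ?e"
    by (subst nn_integral_cmult) (auto simp: nn_integral_normal_vec_density[OF \<sigma>])
  finally show ?thesis .
qed

lemma integral_normal_vec_density:
  assumes "\<sigma> > 0"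
  shows "has_bochner_integral (lebesgue_vec d) (normal_vec_density d \<sigma> v) 1"
  by (rule has_bochner_integral_nn_integral)
     (auto simp: normal_vec_density_nonneg nn_integral_normal_vec_density[OF assms])

lemma normal_vec_mixed_moment:
  assumes \<sigma>: "\<sigma> > 0" and ij: "i < d" "j < d" "i \<noteq> j"
  shows "has_bochner_integral (lebesgue_vec d) (\<lambda>x. normal_vec_density d \<sigma> v x * (x i * x j)) (v i * v j)"
proof -
  interpret finite_product_sigma_finite "\<lambda>_. lborel" "{..<d}" by standard auto
  let ?f = "\<lambda>l y. normal_density (v l) \<sigma> y * (if l \<in> {i, j} then y else 1)"
  have sel: "(\<Prod>l<d. if l \<in> {i, j} then g l else 1) = g i * g j" for g :: "nat \<Rightarrow> real"
  proof -
    have "(\<Prod>l<d. if l \<in> {i, j} then g l else 1) = (\<Prod>l\<in>{i, j}. g l)"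
      using ij by (subst prod.inter_restrict[symmetric]) (auto intro!: prod.cong)
    then show ?thesis using ij by simp
  qed
  have eq: "normal_vec_density d \<sigma> v x * (x i * x j) = (\<Prod>l<d. ?f l (x l))" for x
    unfolding normal_vec_density_def prod.distrib sel ..
  have int: "integrable lborel (?f l)" for l
    using \<sigma> integrable_normal_moment_nz_1[of \<sigma> "v l"] integrable_normal_density[of \<sigma> "v l"]
    by (cases "l \<in> {i, j}") (simp_all del: insert_iff)
  have val: "integral\<^sup>L lborel (?f l) = (if l \<in> {i, j} then v l else 1)" for l
    using \<sigma> integral_normal_moment_nz_1[of \<sigma> "v l"] integral_normal_density[of \<sigma> "v l"]
    by (cases "l \<in> {i, j}") (simp_all del: insert_iff)
  show ?thesis
    unfolding eq lebesgue_vec_def has_bochner_integral_iff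
    using product_integrable_prod[OF finite_lessThan int] product_integral_prod[OF finite_lessThan int]
    by (simp only: val sel simp_thms)
qed

definition symmetrized_density :: "nat \<Rightarrow> real \<Rightarrow> (nat \<Rightarrow> real) \<Rightarrow> (nat \<Rightarrow> real) \<Rightarrow> real" where
  "symmetrized_density d \<sigma> v x = (normal_vec_density d \<sigma> v x + normal_vec_density d \<sigma> (\<lambda>i. - v i) x) / 2"

lemma borel_measurable_symmetrized_density [measurable]:
  "symmetrized_density d \<sigma> v \<in> borel_measurable (lebesgue_vec d)"
  unfolding symmetrized_density_def by measurable

lemma nn_integral_symmetrized_density:
  assumes "\<sigma> > 0"
  shows "(\<integral>\<^sup>+x. ennreal (symmetrized_density d \<sigma> v x) \<partial>lebesgue_vec d) = 1"
proof -
  have "has_bochner_integral (lebesgue_vec d) (symmetrized_density d \<sigma> v) ((1 + 1) / 2)"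
    unfolding symmetrized_density_def
    by (intro has_bochner_integral_divide has_bochner_integral_add integral_normal_vec_density assms)
  then show ?thesis
    by (subst nn_integral_eq_integral)
       (auto simp: has_bochner_integral_iff symmetrized_density_def normal_vec_density_nonneg)
qed

lemma symmetrized_affinity_pointwise:
  fixes v x :: "nat \<Rightarrow> real"
  assumes \<sigma>: "\<sigma> > 0" and j: "j < d"
  defines "ab \<equiv> (\<Sum>i\<in>{..<d}-{j}. v i * x i) / \<sigma>\<^sup>2 * (v j * x j / \<sigma>\<^sup>2)"
    and "f \<equiv> symmetrized_density d \<sigma> v x" and "g \<equiv> symmetrized_density d \<sigma> (v(j := - v j)) x"
  shows "(f + g) / 2 - ab * ((f - g) / 2) \<le> sqrt (f * g)"
proof -
  define a b where "a = (\<Sum>i\<in>{..<d}-{j}. v i * x i) / \<sigma>\<^sup>2" and "b = v j * x j / \<sigma>\<^sup>2"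
  define q where "q = ((\<Sum>i\<in>{..<d}-{j}. (v i)\<^sup>2) + (v j)\<^sup>2) / (2 * \<sigma>\<^sup>2)"
  define K where "K = normal_vec_density d \<sigma> (\<lambda>_. 0) x * exp (- q)"
  have K: "K \<ge> 0" by (simp add: K_def normal_vec_density_nonneg)
  have neg: "(\<lambda>i. - (v(j := c)) i) = (\<lambda>i. - v i)(j := - c)" for c by auto
  have p: "normal_vec_density d \<sigma> (v(j := v j)) x = K * exp (a + b)"
    "normal_vec_density d \<sigma> (v(j := - v j)) x = K * exp (a - b)"
    "normal_vec_density d \<sigma> ((\<lambda>i. - v i)(j := - v j)) x = K * exp (- (a + b))"
    "normal_vec_density d \<sigma> ((\<lambda>i. - v i)(j := v j)) x = K * exp (- (a - b))"
    unfolding normal_vec_density_upd[OF \<sigma> j] K_def a_def b_def q_def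
    by (auto simp: sum_negf exp_add[symmetric] mult.assoc add_divide_distrib diff_divide_distrib algebra_simps)
  have f: "f = K * cosh (a + b)"
    using p(1,3) neg[of "v j"] by (simp add: f_def symmetrized_density_def cosh_def field_simps)
  have g: "g = K * cosh (a - b)"
    using p(2,4) neg[of "- v j"] by (simp add: g_def symmetrized_density_def cosh_def field_simps)
  have "(f + g) / 2 - ab * ((f - g) / 2) = K * (cosh a * cosh b - a * b * (sinh a * sinh b))"
    by (simp add: f g cosh_add cosh_diff ab_def a_def[symmetric] b_def[symmetric] algebra_simps)
  also have "\<dots> \<le> K * sqrt (cosh (a + b) * cosh (a - b))"
    using K by (intro mult_left_mono sqrt_cosh_mult_ge)
  also have "\<dots> = sqrt (f * g)"
    using K by (simp add: f g real_sqrt_mult)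
  finally show ?thesis .
qed

text \<open>
  The pointwise bound integrates to \<open>1 - E[a * b]\<close>, where \<open>b\<close> is the exponent contributed by
  coordinate \<open>j\<close> and \<open>a\<close> the one contributed by the others.  Only mixed second moments of different
  coordinates occur, so the noise variance drops out and the deficit is of fourth order in the mean.
\<close>
lemma affinity_symmetrized_flip:
  assumes \<sigma>: "\<sigma> > 0" and j: "j < d"
  shows "ennreal (1 - (\<Sum>i\<in>{..<d}-{j}. (v i)\<^sup>2) * (v j)\<^sup>2 / \<sigma> ^ 4) \<le>
    (\<integral>\<^sup>+x. ennreal (sqrt (symmetrized_density d \<sigma> v x * symmetrized_density d \<sigma> (v(j := - v j)) x))
      \<partial>lebesgue_vec d)"
proof -
  let ?p = "normal_vec_density d \<sigma>" and ?L = "lebesgue_vec d" and ?J = "{..<d} - {j}"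
  let ?f = "symmetrized_density d \<sigma> v" and ?g = "symmetrized_density d \<sigma> (v(j := - v j))"
  define ab where "ab x = (\<Sum>i\<in>?J. v i * x i) / \<sigma>\<^sup>2 * (v j * x j / \<sigma>\<^sup>2)" for x :: "nat \<Rightarrow> real"
  let ?\<kappa> = "(\<Sum>i\<in>?J. (v i)\<^sup>2) * (v j)\<^sup>2 / \<sigma> ^ 4"
  have ab: "has_bochner_integral ?L (\<lambda>x. ?p u x * ab x) ((\<Sum>i\<in>?J. v i * u i) * (v j * u j) / \<sigma> ^ 4)" for u
  proof -
    have "has_bochner_integral ?L (\<lambda>x. \<Sum>i\<in>?J. (v i * v j / \<sigma> ^ 4) * (?p u x * (x i * x j)))
        (\<Sum>i\<in>?J. (v i * v j / \<sigma> ^ 4) * (u i * u j))"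
      by (intro has_bochner_integral_sum has_bochner_integral_mult_right normal_vec_mixed_moment \<sigma>) (use j in auto)
    moreover have "?p u x * ab x = (\<Sum>i\<in>?J. (v i * v j / \<sigma> ^ 4) * (?p u x * (x i * x j)))" for x
      using \<sigma> by (simp add: ab_def sum_distrib_left sum_distrib_right sum_divide_distrib power4_eq_xxxx power2_eq_square mult_ac)
    moreover have "(\<Sum>i\<in>?J. v i * u i) * (v j * u j) / \<sigma> ^ 4 = (\<Sum>i\<in>?J. (v i * v j / \<sigma> ^ 4) * (u i * u j))"
      by (simp add: sum_distrib_left sum_distrib_right sum_divide_distrib mult_ac)
    ultimately show ?thesis by simp
  qed
  note one = integral_normal_vec_density[OF \<sigma>, of d]
  let ?v' = "v(j := - v j)"
  have same: "(\<Sum>i\<in>?J. v i * ?v' i) = (\<Sum>i\<in>?J. (v i)\<^sup>2)" "(\<Sum>i\<in>?J. v i * v i) = (\<Sum>i\<in>?J. (v i)\<^sup>2)"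
    by (auto intro!: sum.cong simp: power2_eq_square)
  have moments: "has_bochner_integral ?L (\<lambda>x. ?p v x * ab x) ?\<kappa>"
    "has_bochner_integral ?L (\<lambda>x. ?p (\<lambda>i. - v i) x * ab x) ?\<kappa>"
    "has_bochner_integral ?L (\<lambda>x. ?p ?v' x * ab x) (- ?\<kappa>)"
    "has_bochner_integral ?L (\<lambda>x. ?p (\<lambda>i. - ?v' i) x * ab x) (- ?\<kappa>)"
    using ab[of v] ab[of "\<lambda>i. - v i"] ab[of ?v'] ab[of "\<lambda>i. - ?v' i"]
    by (simp_all only: same sum_negf mult_minus_right fun_upd_same)
       (simp_all add: power2_eq_square)
  have "has_bochner_integral ?L (\<lambda>x. 1/4 *
      ((?p v x - ?p v x * ab x) + (?p (\<lambda>i. - v i) x - ?p (\<lambda>i. - v i) x * ab x)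
        + ((?p ?v' x + ?p ?v' x * ab x) + (?p (\<lambda>i. - ?v' i) x + ?p (\<lambda>i. - ?v' i) x * ab x))))
      (1/4 * ((1 - ?\<kappa>) + (1 - ?\<kappa>) + ((1 + - ?\<kappa>) + (1 + - ?\<kappa>))))"
    by (intro has_bochner_integral_mult_right has_bochner_integral_add has_bochner_integral_diff one moments)
  moreover have "(1/4 * ((1 - ?\<kappa>) + (1 - ?\<kappa>) + ((1 + - ?\<kappa>) + (1 + - ?\<kappa>)))) = 1 - ?\<kappa>" by simp
  moreover have "1/4 * ((?p v x - ?p v x * ab x) + (?p (\<lambda>i. - v i) x - ?p (\<lambda>i. - v i) x * ab x)
        + ((?p ?v' x + ?p ?v' x * ab x) + (?p (\<lambda>i. - ?v' i) x + ?p (\<lambda>i. - ?v' i) x * ab x)))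
      = (?f x + ?g x) / 2 - ab x * ((?f x - ?g x) / 2)" for x
    by (simp only: symmetrized_density_def) (simp add: field_simps del: fun_upd_apply)
  ultimately have "has_bochner_integral ?L (\<lambda>x. (?f x + ?g x) / 2 - ab x * ((?f x - ?g x) / 2)) (1 - ?\<kappa>)"
    by (simp only:)
  then have "ennreal (1 - ?\<kappa>) = ennreal (\<integral>x. (?f x + ?g x) / 2 - ab x * ((?f x - ?g x) / 2) \<partial>?L)"
    by (simp add: has_bochner_integral_integral_eq)
  also have "\<dots> \<le> (\<integral>\<^sup>+x. ennreal ((?f x + ?g x) / 2 - ab x * ((?f x - ?g x) / 2)) \<partial>?L)"
    by (rule ennreal_integral_le_nn_integral)
  also have "\<dots> \<le> (\<integral>\<^sup>+x. ennreal (sqrt (?f x * ?g x)) \<partial>?L)"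
    unfolding ab_def using symmetrized_affinity_pointwise[OF \<sigma> j] by (intro nn_integral_mono ennreal_leI)
  finally show ?thesis .
qed

section \<open>Gaussian members of the model class\<close>

definition gauss_law ::
  "nat \<Rightarrow> nat \<Rightarrow> (nat \<Rightarrow> real) \<Rightarrow> (nat \<Rightarrow> nat \<Rightarrow> real) \<Rightarrow> (nat \<Rightarrow> nat \<Rightarrow> real) measure" where
  "gauss_law d m s \<theta> = PiM {0..m} (\<lambda>k. normal_vec d (s k) (\<theta> k))"

lemma sets_gauss_law: "sets (gauss_law d m s \<theta>) = sets (obs_space d m)"
  unfolding gauss_law_def obs_space_def by (intro sets_PiM_cong sets_normal_vec) auto

lemma gauss_law_eq_density:
  assumes "\<And>k. s k > 0"
  shows "gauss_law d m s \<theta> = density (PiM {0..m} (\<lambda>_. lebesgue_vec d))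
    (\<lambda>\<omega>. ennreal (\<Prod>k\<in>{0..m}. normal_vec_density d (s k) (\<theta> k) (\<omega> k)))"
proof -
  have "gauss_law d m s \<theta> = PiM {0..m} (\<lambda>k. density (lebesgue_vec d) (\<lambda>x. ennreal (normal_vec_density d (s k) (\<theta> k) x)))"
    unfolding gauss_law_def by (intro PiM_cong) (auto simp: normal_vec_eq_density assms)
  also have "\<dots> = density (PiM {0..m} (\<lambda>_. lebesgue_vec d))
      (\<lambda>\<omega>. \<Prod>k\<in>{0..m}. ennreal (normal_vec_density d (s k) (\<theta> k) (\<omega> k)))"
    by (rule density_PiM) (auto simp: sigma_finite_lebesgue_vec normal_vec_eq_density[OF assms, symmetric] assms prob_space_normal_vec)
  also have "\<dots> = density (PiM {0..m} (\<lambda>_. lebesgue_vec d))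
    (\<lambda>\<omega>. ennreal (\<Prod>k\<in>{0..m}. normal_vec_density d (s k) (\<theta> k) (\<omega> k)))"
    by (simp add: prod_ennreal normal_vec_density_nonneg)
  finally show ?thesis .
qed

text \<open>
  The tail of the class is the Gaussian one for the standard deviations \<open>s k = \<tau> / sqrt (ns k)\<close>, which
  is what the condition on \<open>s\<close> says; it carries the constant \<open>1/2\<close>, so every \<open>C \<ge> 1/2\<close> is admissible.
\<close>
lemma gauss_law_in_model_class:
  assumes C: "C \<ge> 1/2" and s: "\<And>k. k \<le> m \<Longrightarrow> s k > 0" "\<And>k. k \<le> m \<Longrightarrow> real (ns k) * (s k)\<^sup>2 = \<tau>\<^sup>2"
    and \<tau>: "\<tau> > 0" and \<theta>: "\<theta> \<in> space (obs_space d m)"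
    and h: "\<And>k. k \<in> {1..m} \<Longrightarrow> L2_set (\<lambda>j. \<theta> k j - \<theta> 0 j) {..<d} \<le> h k"
  shows "(gauss_law d m s \<theta>, \<theta>) \<in> model_class C d m h ns \<tau>"
proof -
  let ?P = "gauss_law d m s \<theta>" and ?N = "\<lambda>k. normal_vec d (s k) (\<theta> k)"
  have N: "prob_space (?N k)" if "k \<in> {0..m}" for k using s that by (intro prob_space_normal_vec) auto
  interpret P: prob_space ?P unfolding gauss_law_def by (rule prob_space_PiM[OF N])
  have "P.indep_vars ?N (\<lambda>k \<omega>. \<omega> k) {0..m}"
    unfolding gauss_law_def by (rule indep_vars_PiM_coordinates) (use N in auto)
  then have "P.indep_vars (\<lambda>_. vec_space d) (\<lambda>k \<omega>. (\<lambda>x. x) (\<omega> k)) {0..m}"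
    by (rule P.indep_vars_compose2) (simp add: measurable_ident_sets sets_normal_vec)
  moreover have "measure ?P {\<omega> \<in> space ?P. (\<Sum>j<d. a j * (\<omega> k j - \<theta> k j)) > t}
          \<le> C * exp (- (real (ns k) * t\<^sup>2 / (2 * \<tau>\<^sup>2)))"
    if k: "k \<in> {0..m}" and a: "L2_set a {..<d} = 1" and t: "t > 0" for k a t
  proof -
    let ?A = "{x \<in> space (?N k). (\<Sum>j<d. a j * (x j - \<theta> k j)) > t}"
    have sk: "s k > 0" using s k by auto
    have "(\<lambda>x. \<Sum>j<d. a j * (x j - \<theta> k j)) \<in> borel_measurable (?N k)"
      using distributed_normal_vec_unit_direction[OF sk a, of "\<theta> k"] by (simp add: distributed_def)
    then have A: "?A \<in> sets (?N k)" by measurable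
    have meas: "(\<lambda>\<omega>. \<omega> k) \<in> measurable ?P (?N k)"
      unfolding gauss_law_def using k by (rule measurable_component_singleton)
    have "measure ?P {\<omega> \<in> space ?P. (\<Sum>j<d. a j * (\<omega> k j - \<theta> k j)) > t} = measure ?P ((\<lambda>\<omega>. \<omega> k) -` ?A \<inter> space ?P)"
      using measurable_space[OF meas] by (intro arg_cong[where f = "measure ?P"]) auto
    also have "\<dots> = measure (distr ?P (?N k) (\<lambda>\<omega>. \<omega> k)) ?A"
      by (rule measure_distr[OF meas A, symmetric])
    also have "distr ?P (?N k) (\<lambda>\<omega>. \<omega> k) = ?N k"
      unfolding gauss_law_def by (rule distr_PiM_component[OF N k])
    also have "measure (?N k) ?A \<le> 1/2 * exp (- (t\<^sup>2 / (2 * (s k)\<^sup>2)))"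
      by (rule normal_vec_tail[OF sk a t])
    also have "\<dots> \<le> C * exp (- (t\<^sup>2 / (2 * (s k)\<^sup>2)))" using C by (intro mult_right_mono) auto
    also have "t\<^sup>2 / (2 * (s k)\<^sup>2) = real (ns k) * t\<^sup>2 / (2 * \<tau>\<^sup>2)"
    proof -
      have eq: "real (ns k) * (s k)\<^sup>2 = \<tau>\<^sup>2" using s(2) k by auto
      then have "ns k \<noteq> 0" using \<tau> by (intro notI) simp
      then show ?thesis using sk unfolding eq[symmetric] by simp
    qed
    finally show ?thesis .
  qed
  ultimately show ?thesis
    unfolding model_class_def using P.prob_space_axioms \<theta> h by (auto simp: sets_gauss_law)
qed

lemma oracle_rate_le_clean:
  assumes S: "S \<subseteq> {1..m}" and h: "\<And>k. k \<in> S \<Longrightarrow> h k = 0"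
  shows "oracle_rate d m h ns \<tau> \<le> real d * \<tau>\<^sup>2 / (real (ns 0) + (\<Sum>k\<in>S. real (ns k)))"
proof -
  have fin: "finite S" using S by (rule finite_subset) auto
  have "0 \<notin> S" using S by auto
  let ?r = "\<lambda>S. real d * \<tau>\<^sup>2 / (\<Sum>k\<in>S. real (ns k)) + Max ((\<lambda>k. ((h(0 := 0)) k)\<^sup>2) ` S)"
  have "oracle_rate d m h ns \<tau> \<le> ?r (insert 0 S)"
    unfolding oracle_rate_def using S by (intro Min_le finite_imageI imageI) auto
  also have "(\<lambda>k. ((h(0 := 0)) k)\<^sup>2) ` insert 0 S = {0}" using h by auto
  finally show ?thesis using fin \<open>0 \<notin> S\<close> by simp
qed

lemma inverse_ennreal_antimono: "x \<le> y \<Longrightarrow> inverse y \<le> inverse (x :: ennreal)"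
proof (cases x)
  case (real r)
  assume "x \<le> y"
  then show ?thesis using real
    by (cases y; cases "r = 0") (auto simp: inverse_ennreal ennreal_le_iff intro!: ennreal_leI)
qed (simp add: top_unique)

text \<open>
  The bias bounds \<open>h\<close> are taken to be the exact distances of the parameters from that of the target,
  which vanish on \<open>S\<close>.  The bound is multiplied out, since the factor on the left is the one over which
  the risks will be averaged.
\<close>
lemma adaptation_cost_ge_clean_risk:
  assumes C: "C \<ge> 1/2" and s: "\<And>k. k \<le> m \<Longrightarrow> s k > 0" "\<And>k. k \<le> m \<Longrightarrow> real (ns k) * (s k)\<^sup>2 = \<tau>\<^sup>2"
    and d: "d \<ge> 1" and \<tau>: "\<tau> > 0"
    and \<theta>: "\<theta> \<in> space (obs_space d m)"
    and bias: "\<And>k. k \<in> {1..m} \<Longrightarrow> L2_set (\<lambda>j. \<theta> k j - \<theta> 0 j) {..<d} \<le> 1"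
    and S: "S \<subseteq> {1..m}" and clean: "\<And>k. k \<in> S \<Longrightarrow> \<theta> k = \<theta> 0"
  shows "ennreal (real (ns 0) + (\<Sum>k\<in>S. real (ns k))) * sq_risk d est (gauss_law d m s \<theta>) \<theta>
    \<le> ennreal (real d * \<tau>\<^sup>2) * adaptation_cost C d m ns \<tau> est ({1..m} \<rightarrow>\<^sub>E {0..1})"
proof -
  define h where "h = (\<lambda>k\<in>{1..m}. L2_set (\<lambda>j. \<theta> k j - \<theta> 0 j) {..<d})"
  let ?K = "adaptation_cost C d m ns \<tau> est ({1..m} \<rightarrow>\<^sub>E {0..1})"
  let ?R = "oracle_rate d m h ns \<tau>" and ?risk = "sq_risk d est (gauss_law d m s \<theta>) \<theta>"
  let ?N = "real (ns 0) + (\<Sum>k\<in>S. real (ns k))" and ?D = "real d * \<tau>\<^sup>2"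
  have h: "h \<in> {1..m} \<rightarrow>\<^sub>E {0..1}" using bias by (auto simp: h_def)
  have "ns 0 \<noteq> 0" using s(2)[of 0] \<tau> by (intro notI) simp
  then have N: "?N > 0" by (simp add: add_pos_nonneg sum_nonneg)
  have D: "?D > 0" using d \<tau> by simp
  have "(gauss_law d m s \<theta>, \<theta>) \<in> model_class C d m h ns \<tau>"
    by (rule gauss_law_in_model_class[OF C s \<tau> \<theta>]) (auto simp: h_def)
  then have "?risk \<le> (SUP (P, \<theta>)\<in>model_class C d m h ns \<tau>. sq_risk d est P \<theta>)"
    by (intro SUP_upper2[where i = "(gauss_law d m s \<theta>, \<theta>)"]) auto
  then have "?risk / ennreal ?R \<le> (SUP (P, \<theta>)\<in>model_class C d m h ns \<tau>. sq_risk d est P \<theta>) / ennreal ?R"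
    by (rule divide_right_mono_ennreal)
  also have "\<dots> \<le> ?K"
    unfolding adaptation_cost_def by (rule SUP_upper[OF h])
  finally have K: "?risk / ennreal ?R \<le> ?K" .
  have "?R \<le> ?D / ?N"
    by (rule oracle_rate_le_clean[OF S]) (use S clean in \<open>auto simp: h_def subset_eq L2_set_def\<close>)
  then have "?risk / ennreal (?D / ?N) \<le> ?risk / ennreal ?R"
    unfolding divide_ennreal_def by (intro mult_left_mono inverse_ennreal_antimono ennreal_leI) auto
  also note K
  finally have "ennreal ?D * (?risk / ennreal (?D / ?N)) \<le> ennreal ?D * ?K" by (rule mult_left_mono) simp
  moreover have "ennreal ?D * (?risk / ennreal (?D / ?N)) = ennreal ?N * ?risk"
  proof -
    have "ennreal ?D * (?risk / ennreal (?D / ?N)) = (ennreal ?D * inverse (ennreal (?D / ?N))) * ?risk"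
      by (simp add: divide_ennreal_def mult_ac)
    also have "ennreal ?D * inverse (ennreal (?D / ?N)) = ennreal ?N"
      using N D d \<tau> by (simp add: inverse_ennreal ennreal_mult[symmetric])
    finally show ?thesis .
  qed
  ultimately show ?thesis by simp
qed

section \<open>Hidden source labels\<close>

definition sign_params :: "nat \<Rightarrow> nat \<Rightarrow> (nat \<Rightarrow> real) \<Rightarrow> (nat \<Rightarrow> real) \<Rightarrow> nat \<Rightarrow> nat \<Rightarrow> real" where
  "sign_params d m v l = (\<lambda>k\<in>{0..m}. \<lambda>j\<in>{..<d}. l k * v j)"

text \<open>
  The labels on \<open>F\<close> are known to be \<open>1\<close>.  The target is treated as a domain with known label, so \<open>F\<close>
  always contains \<open>0\<close>.
\<close>
definition sign_labels :: "nat \<Rightarrow> nat set \<Rightarrow> (nat \<Rightarrow> real) set" where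
  "sign_labels m F = PiE {0..m} (\<lambda>k. if k \<in> F then {1} else {1, -1})"

definition hypercube :: "nat \<Rightarrow> real \<Rightarrow> (nat \<Rightarrow> real) set" where
  "hypercube d \<epsilon> = PiE {..<d} (\<lambda>_. {\<epsilon>, - \<epsilon>})"

text \<open>The density of the local estimator \<open>k\<close> after averaging over its label.\<close>
definition label_mixture ::
  "nat \<Rightarrow> (nat \<Rightarrow> real) \<Rightarrow> nat set \<Rightarrow> (nat \<Rightarrow> real) \<Rightarrow> nat \<Rightarrow> (nat \<Rightarrow> real) \<Rightarrow> real" where
  "label_mixture d s F v k = (if k \<in> F then normal_vec_density d (s k) v else symmetrized_density d (s k) v)"

lemma borel_measurable_label_mixture [measurable]:
  "label_mixture d s F v k \<in> borel_measurable (lebesgue_vec d)"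
  by (cases "k \<in> F") (simp_all add: label_mixture_def)

lemma label_mixture_nonneg: "0 \<le> label_mixture d s F v k x"
  by (simp add: label_mixture_def symmetrized_density_def normal_vec_density_nonneg)

lemma finite_sign_labels: "finite (sign_labels m F)"
  unfolding sign_labels_def by (intro finite_PiE) auto

lemma card_sign_labels: "card (sign_labels m F) = (\<Prod>k\<in>{0..m}. if k \<in> F then 1 else 2)"
  unfolding sign_labels_def by (subst card_PiE) (auto intro!: prod.cong)

lemma sets_obs_space: "sets (PiM {0..m} (\<lambda>_. lebesgue_vec d)) = sets (obs_space d m)"
  unfolding obs_space_def by (intro sets_PiM_cong sets_lebesgue_vec) auto

text \<open>
  Summing the product densities over all label vectors is the same as taking the product of the label
  sums of the factors, so independent uniform labels lead to a product of mixtures.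
\<close>
lemma sum_over_labels:
  assumes s: "\<And>k. s k > 0" and f: "f \<in> borel_measurable (obs_space d m)"
  shows "(\<Sum>l\<in>sign_labels m F. \<integral>\<^sup>+\<omega>. f \<omega> \<partial>gauss_law d m s (sign_params d m v l))
    = of_nat (card (sign_labels m F)) *
      (\<integral>\<^sup>+\<omega>. f \<omega> * ennreal (\<Prod>k\<in>{0..m}. label_mixture d s F v k (\<omega> k)) \<partial>PiM {0..m} (\<lambda>_. lebesgue_vec d))"
proof -
  let ?L = "PiM {0..m} (\<lambda>_. lebesgue_vec d)" and ?B = "\<lambda>k. if k \<in> F then {1} else {1, -1::real}"
  let ?p = "\<lambda>k c. normal_vec_density d (s k) (\<lambda>j. c * v j)"
  have [measurable]: "f \<in> borel_measurable ?L"
    using f by (simp add: measurable_cong_sets[OF sets_obs_space refl])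
  have prodm: "(\<lambda>\<omega>. \<Prod>k\<in>{0..m}. g k (\<omega> k)) \<in> borel_measurable ?L"
    if [measurable]: "\<And>k. g k \<in> borel_measurable (lebesgue_vec d)" for g :: "nat \<Rightarrow> (nat \<Rightarrow> real) \<Rightarrow> real"
    by measurable
  have law: "(\<integral>\<^sup>+\<omega>. f \<omega> \<partial>gauss_law d m s (sign_params d m v l))
      = (\<integral>\<^sup>+\<omega>. f \<omega> * ennreal (\<Prod>k\<in>{0..m}. ?p k (l k) (\<omega> k)) \<partial>?L)" for l
  proof -
    have "normal_vec_density d (s k) (sign_params d m v l k) = ?p k (l k)" if "k \<in> {0..m}" for k
      using that by (auto simp: sign_params_def normal_vec_density_def fun_eq_iff intro!: prod.cong)
    then show ?thesis
      unfolding gauss_law_eq_density[OF s]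
      by (subst nn_integral_density) (auto simp: mult.commute intro!: measurable_compose[OF prodm] nn_integral_cong)
  qed
  have "(\<Sum>l\<in>sign_labels m F. \<integral>\<^sup>+\<omega>. f \<omega> \<partial>gauss_law d m s (sign_params d m v l))
      = (\<integral>\<^sup>+\<omega>. (\<Sum>l\<in>sign_labels m F. f \<omega> * ennreal (\<Prod>k\<in>{0..m}. ?p k (l k) (\<omega> k))) \<partial>?L)"
    unfolding law using prodm by (subst nn_integral_sum) auto
  also have "\<dots> = (\<integral>\<^sup>+\<omega>. of_nat (card (sign_labels m F)) *
      (f \<omega> * ennreal (\<Prod>k\<in>{0..m}. label_mixture d s F v k (\<omega> k))) \<partial>?L)"
  proof (rule nn_integral_cong)
    fix \<omega>
    have mix: "(\<Sum>c\<in>?B k. ?p k c (\<omega> k)) = (if k \<in> F then 1 else 2) * label_mixture d s F v k (\<omega> k)" for k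
      by (simp add: label_mixture_def symmetrized_density_def)
    have "(\<Sum>l\<in>sign_labels m F. \<Prod>k\<in>{0..m}. ?p k (l k) (\<omega> k)) = (\<Prod>k\<in>{0..m}. \<Sum>c\<in>?B k. ?p k c (\<omega> k))"
      unfolding sign_labels_def by (rule prod_sum_PiE[symmetric]) auto
    also have "\<dots> = real (card (sign_labels m F)) * (\<Prod>k\<in>{0..m}. label_mixture d s F v k (\<omega> k))"
      unfolding mix prod.distrib card_sign_labels of_nat_prod by (auto intro!: prod.cong)
    finally have eq: "(\<Sum>l\<in>sign_labels m F. \<Prod>k\<in>{0..m}. ?p k (l k) (\<omega> k))
      = real (card (sign_labels m F)) * (\<Prod>k\<in>{0..m}. label_mixture d s F v k (\<omega> k))" .
    have "(\<Sum>l\<in>sign_labels m F. f \<omega> * ennreal (\<Prod>k\<in>{0..m}. ?p k (l k) (\<omega> k)))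
        = f \<omega> * ennreal (\<Sum>l\<in>sign_labels m F. \<Prod>k\<in>{0..m}. ?p k (l k) (\<omega> k))"
      unfolding sum_distrib_left[symmetric]
      by (subst sum_ennreal) (auto intro!: prod_nonneg normal_vec_density_nonneg)
    then show "(\<Sum>l\<in>sign_labels m F. f \<omega> * ennreal (\<Prod>k\<in>{0..m}. ?p k (l k) (\<omega> k)))
        = of_nat (card (sign_labels m F)) * (f \<omega> * ennreal (\<Prod>k\<in>{0..m}. label_mixture d s F v k (\<omega> k)))"
      unfolding eq by (simp add: ennreal_mult prod_nonneg label_mixture_nonneg ennreal_of_nat_eq_real_of_nat mult_ac)
  qed
  also have "\<dots> = of_nat (card (sign_labels m F)) *
      (\<integral>\<^sup>+\<omega>. f \<omega> * ennreal (\<Prod>k\<in>{0..m}. label_mixture d s F v k (\<omega> k)) \<partial>?L)"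
    using prodm[of "label_mixture d s F v"] by (intro nn_integral_cmult) auto
  finally show ?thesis .
qed

text \<open>
  The condition sums the affinity deficits of all domains when one coordinate of \<open>v\<close> changes sign:
  known labels contribute second order terms in \<open>\<epsilon>\<close>, hidden ones fourth order terms.
\<close>
lemma flip_pair_risk:
  assumes s: "\<And>k. s k > 0" and e: "e \<in> borel_measurable (obs_space d m)" and j: "j < d"
    and v: "\<And>i. i < d \<Longrightarrow> (v i)\<^sup>2 = \<epsilon>\<^sup>2"
    and \<delta>: "(\<Sum>k\<in>{0..m}. if k \<in> F then \<epsilon>\<^sup>2 / (2 * (s k)\<^sup>2) else real d * \<epsilon> ^ 4 / (s k) ^ 4) \<le> 1/2"
  defines "T \<equiv> \<lambda>v. \<integral>\<^sup>+\<omega>. ennreal ((e \<omega> - v j)\<^sup>2) * ennreal (\<Prod>k\<in>{0..m}. label_mixture d s F v k (\<omega> k))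
      \<partial>PiM {0..m} (\<lambda>_. lebesgue_vec d)"
  shows "ennreal (\<epsilon>\<^sup>2 / 4) \<le> T v + T (v(j := - v j))"
proof -
  let ?\<delta> = "\<lambda>k. if k \<in> F then \<epsilon>\<^sup>2 / (2 * (s k)\<^sup>2) else real d * \<epsilon> ^ 4 / (s k) ^ 4"
  let ?w = "v(j := - v j)"
  have vj: "(v j)\<^sup>2 = \<epsilon>\<^sup>2" using v j by simp
  have mass: "(\<integral>\<^sup>+x. ennreal (label_mixture d s F u k x) \<partial>lebesgue_vec d) = 1" for u k
    using nn_integral_normal_vec_density[OF s[of k], of d u] nn_integral_symmetrized_density[OF s[of k], of d u]
    by (cases "k \<in> F") (simp_all add: label_mixture_def)
  have aff: "ennreal (1 - ?\<delta> k) \<le>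
      (\<integral>\<^sup>+x. ennreal (sqrt (label_mixture d s F v k x * label_mixture d s F ?w k x)) \<partial>lebesgue_vec d)" for k
  proof (cases "k \<in> F")
    case True
    have "1 - ?\<delta> k \<le> exp (- ((v j)\<^sup>2 / (2 * (s k)\<^sup>2)))"
      using exp_ge_add_one_self[of "- ((v j)\<^sup>2 / (2 * (s k)\<^sup>2))"] True vj by simp
    then show ?thesis
      using True affinity_normal_vec_flip[OF s[of k] j, of v] by (simp add: label_mixture_def ennreal_leI)
  next
    case False
    have "(\<Sum>i\<in>{..<d}-{j}. (v i)\<^sup>2) \<le> real d * \<epsilon>\<^sup>2"
    proof -
      have "(\<Sum>i\<in>{..<d}-{j}. (v i)\<^sup>2) \<le> (\<Sum>i<d. (v i)\<^sup>2)" by (intro sum_mono2) auto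
      then show ?thesis using v by simp
    qed
    then have "(\<Sum>i\<in>{..<d}-{j}. (v i)\<^sup>2) * (v j)\<^sup>2 / (s k) ^ 4 \<le> (real d * \<epsilon>\<^sup>2) * (v j)\<^sup>2 / (s k) ^ 4"
      by (intro divide_right_mono mult_right_mono) auto
    also have "\<dots> = ?\<delta> k" using False vj by (simp add: power4_eq_xxxx power2_eq_square)
    finally have "ennreal (1 - ?\<delta> k) \<le> ennreal (1 - (\<Sum>i\<in>{..<d}-{j}. (v i)\<^sup>2) * (v j)\<^sup>2 / (s k) ^ 4)"
      by (intro ennreal_leI) simp
    also note affinity_symmetrized_flip[OF s[of k] j, of v]
    finally show ?thesis using False by (simp add: label_mixture_def)
  qed
  have "ennreal ((v j)\<^sup>2 / 4) \<le>
    (\<integral>\<^sup>+\<omega>. ennreal ((e \<omega> - v j)\<^sup>2) * ennreal (\<Prod>k\<in>{0..m}. label_mixture d s F v k (\<omega> k)) \<partial>PiM {0..m} (\<lambda>_. lebesgue_vec d))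
    + (\<integral>\<^sup>+\<omega>. ennreal ((e \<omega> + v j)\<^sup>2) * ennreal (\<Prod>k\<in>{0..m}. label_mixture d s F ?w k (\<omega> k)) \<partial>PiM {0..m} (\<lambda>_. lebesgue_vec d))"
  proof (rule two_point_risk[where \<delta> = ?\<delta>])
    show "e \<in> borel_measurable (PiM {0..m} (\<lambda>_. lebesgue_vec d))"
      using e by (simp add: measurable_cong_sets[OF sets_obs_space refl])
    show "ennreal (1 - ?\<delta> k) \<le>
      (\<integral>\<^sup>+x. ennreal (sqrt (label_mixture d s F v k x * label_mixture d s F ?w k x)) \<partial>lebesgue_vec d)" for k
      by (rule aff)
    show "0 \<le> ?\<delta> k" for k by simp
  qed (use \<delta> in \<open>simp_all only: sigma_finite_lebesgue_vec label_mixture_nonneg mass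
        borel_measurable_label_mixture finite_atLeastAtMost\<close>)
  then show ?thesis by (simp add: T_def vj)
qed

lemma hypercube_sq: "v \<in> hypercube d \<epsilon> \<Longrightarrow> i < d \<Longrightarrow> (v i)\<^sup>2 = \<epsilon>\<^sup>2"
  by (fastforce simp: hypercube_def PiE_def Pi_def)

lemma finite_hypercube: "finite (hypercube d \<epsilon>)"
  unfolding hypercube_def by (intro finite_PiE) auto

lemma sum_hypercube_flip:
  assumes "j < d"
  shows "(\<Sum>v\<in>hypercube d \<epsilon>. f (v(j := - v j))) = (\<Sum>v\<in>hypercube d \<epsilon>. f v)"
proof (rule sum.reindex_bij_witness[where i = "\<lambda>v. v(j := - v j)" and j = "\<lambda>v. v(j := - v j)"])
  show "v(j := - v j) \<in> hypercube d \<epsilon>" if "v \<in> hypercube d \<epsilon>" for v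
    using that assms by (auto simp: hypercube_def PiE_def Pi_def extensional_def)
  then show "v(j := - v j) \<in> hypercube d \<epsilon>" if "v \<in> hypercube d \<epsilon>" for v using that .
qed auto

lemma estimator_component_measurable:
  assumes "est \<in> measurable (obs_space d m) (vec_space d)" "j < d"
  shows "(\<lambda>\<omega>. est \<omega> j) \<in> borel_measurable (obs_space d m)"
  by (rule measurable_compose[OF assms(1)]) (use assms(2) in \<open>simp add: vec_space_def\<close>)

lemma sq_risk_eq_sum:
  assumes est: "est \<in> measurable (obs_space d m) (vec_space d)"
    and \<theta>: "\<And>j. j < d \<Longrightarrow> \<theta> 0 j = v j"
  shows "sq_risk d est (gauss_law d m s \<theta>) \<theta> = (\<Sum>j<d. \<integral>\<^sup>+\<omega>. ennreal ((est \<omega> j - v j)\<^sup>2) \<partial>gauss_law d m s \<theta>)"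
proof -
  have "(L2_set (\<lambda>j. est \<omega> j - \<theta> 0 j) {..<d})\<^sup>2 = (\<Sum>j<d. (est \<omega> j - v j)\<^sup>2)" for \<omega>
    using \<theta> by (simp add: L2_set_def sum_nonneg)
  then have "sq_risk d est (gauss_law d m s \<theta>) \<theta> = (\<integral>\<^sup>+\<omega>. (\<Sum>j<d. ennreal ((est \<omega> j - v j)\<^sup>2)) \<partial>gauss_law d m s \<theta>)"
    unfolding sq_risk_def by (simp add: sum_ennreal)
  also have "\<dots> = (\<Sum>j<d. \<integral>\<^sup>+\<omega>. ennreal ((est \<omega> j - v j)\<^sup>2) \<partial>gauss_law d m s \<theta>)"
  proof (rule nn_integral_sum)
    fix j assume "j \<in> {..<d}"
    then have "(\<lambda>\<omega>. est \<omega> j) \<in> borel_measurable (obs_space d m)"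
      using estimator_component_measurable[OF est] by simp
    then have [measurable]: "(\<lambda>\<omega>. est \<omega> j) \<in> borel_measurable (gauss_law d m s \<theta>)"
      by (simp add: measurable_cong_sets[OF sets_gauss_law refl])
    show "(\<lambda>\<omega>. ennreal ((est \<omega> j - v j)\<^sup>2)) \<in> borel_measurable (gauss_law d m s \<theta>)" by measurable
  qed
  finally show ?thesis .
qed

text \<open>
  The squared norm splits over the coordinates.  For each coordinate \<open>j\<close> the cube is partitioned into
  pairs of points that differ in the sign of coordinate \<open>j\<close>, and the two-point bound applies to each
  pair.
\<close>
lemma assouad_sign_mixture:
  assumes s: "\<And>k. s k > 0" and est: "est \<in> measurable (obs_space d m) (vec_space d)" and F: "0 \<in> F"
    and \<delta>: "(\<Sum>k\<in>{0..m}. if k \<in> F then \<epsilon>\<^sup>2 / (2 * (s k)\<^sup>2) else real d * \<epsilon> ^ 4 / (s k) ^ 4) \<le> 1/2"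
  shows "ennreal (real (card (hypercube d \<epsilon>)) * real (card (sign_labels m F)) * (real d * \<epsilon>\<^sup>2 / 8)) \<le>
    (\<Sum>v\<in>hypercube d \<epsilon>. \<Sum>l\<in>sign_labels m F.
       sq_risk d est (gauss_law d m s (sign_params d m v l)) (sign_params d m v l))"
proof -
  let ?H = "hypercube d \<epsilon>" and ?L = "sign_labels m F"
  let ?T = "\<lambda>j v. \<integral>\<^sup>+\<omega>. ennreal ((est \<omega> j - v j)\<^sup>2) * ennreal (\<Prod>k\<in>{0..m}. label_mixture d s F v k (\<omega> k))
      \<partial>PiM {0..m} (\<lambda>_. lebesgue_vec d)"
  have coord: "ennreal (real (card ?H) * (\<epsilon>\<^sup>2 / 8)) \<le> (\<Sum>v\<in>?H. ?T j v)" if j: "j < d" for j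
  proof -
    have "ennreal (real (card ?H) * (\<epsilon>\<^sup>2 / 4)) = (\<Sum>v\<in>?H. ennreal (\<epsilon>\<^sup>2 / 4))"
      by (simp add: ennreal_mult[symmetric] ennreal_of_nat_eq_real_of_nat)
    also have "\<dots> \<le> (\<Sum>v\<in>?H. ?T j v + ?T j (v(j := - v j)))"
      by (intro sum_mono flip_pair_risk[OF s estimator_component_measurable[OF est j] j _ \<delta>] hypercube_sq)
    also have "\<dots> = 2 * (\<Sum>v\<in>?H. ?T j v)"
      unfolding sum.distrib sum_hypercube_flip[OF j, of "?T j"] by (simp add: mult_2)
    finally have "ennreal (real (card ?H) * (\<epsilon>\<^sup>2 / 4)) \<le> 2 * (\<Sum>v\<in>?H. ?T j v)" .
    then have "ennreal (1/2) * ennreal (real (card ?H) * (\<epsilon>\<^sup>2 / 4)) \<le> ennreal (1/2) * (2 * (\<Sum>v\<in>?H. ?T j v))"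
      by (rule mult_left_mono) simp
    also have "\<dots> = (ennreal (1/2) * ennreal 2) * (\<Sum>v\<in>?H. ?T j v)" by (simp add: mult.assoc)
    also have "ennreal (1/2) * ennreal 2 = 1" by (subst ennreal_mult[symmetric]) simp_all
    finally show ?thesis by (subst (asm) ennreal_mult[symmetric]) simp_all
  qed
  have "ennreal (real (card ?H) * real (card ?L) * (real d * \<epsilon>\<^sup>2 / 8))
      = ennreal (real (card ?L)) * (\<Sum>j<d. ennreal (real (card ?H) * (\<epsilon>\<^sup>2 / 8)))"
    by (simp add: ennreal_mult[symmetric] ennreal_of_nat_eq_real_of_nat mult_ac)
  also have "\<dots> \<le> of_nat (card ?L) * (\<Sum>j<d. \<Sum>v\<in>?H. ?T j v)"
    using coord by (intro mult_mono sum_mono) (auto simp: ennreal_of_nat_eq_real_of_nat)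
  also have "\<dots> = (\<Sum>v\<in>?H. \<Sum>j<d. of_nat (card ?L) * ?T j v)"
    by (subst sum.swap) (simp add: sum_distrib_left)
  also have "\<dots> = (\<Sum>v\<in>?H. \<Sum>j<d. \<Sum>l\<in>?L. \<integral>\<^sup>+\<omega>. ennreal ((est \<omega> j - v j)\<^sup>2) \<partial>gauss_law d m s (sign_params d m v l))"
  proof (intro sum.cong refl)
    fix v j assume "j \<in> {..<d}"
    then have [measurable]: "(\<lambda>\<omega>. est \<omega> j) \<in> borel_measurable (obs_space d m)"
      using estimator_component_measurable[OF est] by simp
    show "of_nat (card ?L) * ?T j v =
        (\<Sum>l\<in>?L. \<integral>\<^sup>+\<omega>. ennreal ((est \<omega> j - v j)\<^sup>2) \<partial>gauss_law d m s (sign_params d m v l))"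
      by (rule sum_over_labels[OF s, symmetric]) measurable
  qed
  also have "\<dots> = (\<Sum>v\<in>?H. \<Sum>l\<in>?L. \<Sum>j<d. \<integral>\<^sup>+\<omega>. ennreal ((est \<omega> j - v j)\<^sup>2) \<partial>gauss_law d m s (sign_params d m v l))"
    by (subst sum.swap) simp
  also have "\<dots> = (\<Sum>v\<in>?H. \<Sum>l\<in>?L.
       sq_risk d est (gauss_law d m s (sign_params d m v l)) (sign_params d m v l))"
  proof (intro sum.cong refl sq_risk_eq_sum[OF est, symmetric])
    fix v l j assume "l \<in> ?L" "j < d"
    then have "l 0 = 1" using F by (force simp: sign_labels_def PiE_def Pi_def)
    then show "sign_params d m v l 0 j = v j" using \<open>j < d\<close> by (simp add: sign_params_def)
  qed
  finally show ?thesis .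
qed

lemma ennreal_divide_le_of_le_mult:
  assumes "b > 0" "ennreal a \<le> ennreal b * K"
  shows "ennreal (a / b) \<le> K"
proof (cases K)
  case (real r)
  then have "ennreal a \<le> ennreal (b * r)" using assms by (simp add: ennreal_mult)
  then have "a \<le> b * r" using assms(1) real by (subst (asm) ennreal_le_iff) auto
  then show ?thesis using real assms(1) by (auto intro!: ennreal_leI simp: divide_le_eq mult.commute)
qed simp

lemma sign_labels_fixed_coordinate:
  assumes "k \<in> {1..m}"
  shows "sign_labels m {0, k} = {l \<in> sign_labels m {0}. l k = 1}"
    and "2 * card (sign_labels m {0, k}) = card (sign_labels m {0})"
proof -
  show "sign_labels m {0, k} = {l \<in> sign_labels m {0}. l k = 1}"
    using assms by (auto simp: sign_labels_def PiE_def Pi_def split: if_splits)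
  have card: "card (sign_labels m F) = 2 ^ card ({0..m} - F)" for F
  proof -
    have "card (sign_labels m F) = (\<Prod>k\<in>{0..m} - F. 2)"
      unfolding card_sign_labels by (rule prod.mono_neutral_cong_right) auto
    then show ?thesis by simp
  qed
  have "{0..m} - {0} = insert k ({0..m} - {0, k})" using assms by auto
  then have "card ({0..m} - {0}) = Suc (card ({0..m} - {0, k}))"
    using assms by (metis card_insert_disjoint DiffD2 finite_Diff finite_atLeastAtMost insertI1 insertI2)
  then show "2 * card (sign_labels m {0, k}) = card (sign_labels m {0})"
    by (simp only: card power_Suc)
qed

text \<open>
  The target and the at most one source with known label contribute \<open>1/8\<close> each, and the hidden
  sources together \<open>1/16\<close>.
\<close>
lemma affinity_deficits_le_half:
  assumes k: "k \<in> {1..m}" and F: "0 \<in> F" "F \<subseteq> {0, k}" and \<tau>: "\<tau> > 0"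
    and s: "\<And>i. s i = \<tau> / sqrt (if i = 0 then n\<^sub>0 else n)" and n: "n\<^sub>0 > 0" "n > 0"
    and \<epsilon>0: "\<epsilon>\<^sup>2 * n\<^sub>0 \<le> \<tau>\<^sup>2 / 4" and \<epsilon>1: "\<epsilon>\<^sup>2 * n \<le> \<tau>\<^sup>2 / 4"
    and \<epsilon>m: "real d * real m * (\<epsilon>\<^sup>2 * n)\<^sup>2 \<le> (\<tau>\<^sup>2)\<^sup>2 / 16"
  shows "(\<Sum>i\<in>{0..m}. if i \<in> F then \<epsilon>\<^sup>2 / (2 * (s i)\<^sup>2) else real d * \<epsilon> ^ 4 / (s i) ^ 4) \<le> 1/2"
proof -
  let ?f = "\<lambda>i. if i \<in> F then \<epsilon>\<^sup>2 / (2 * (s i)\<^sup>2) else real d * \<epsilon> ^ 4 / (s i) ^ 4"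
  have s0: "(s 0)\<^sup>2 = \<tau>\<^sup>2 / n\<^sub>0" and sn: "(s i)\<^sup>2 = \<tau>\<^sup>2 / n" if "i \<noteq> 0" for i
    using that n by (simp_all add: s power_divide)
  have "?f 0 \<le> 1/8"
    using F n \<tau> \<epsilon>0 by (simp add: s power_divide field_simps)
  moreover have "(\<Sum>i\<in>{1..m}. ?f i) \<le> (\<Sum>i\<in>{1..m}. (if i = k then 1/8 else 0) + 1 / (16 * real m))"
  proof (rule sum_mono)
    fix i assume i: "i \<in> {1..m}"
    show "?f i \<le> (if i = k then 1/8 else 0) + 1 / (16 * real m)"
    proof (cases "i \<in> F")
      case True
      then have "i = k" using F i by auto
      have "\<epsilon>\<^sup>2 / (2 * (s i)\<^sup>2) \<le> 1/8"
        using i n \<tau> \<epsilon>1 by (simp add: sn field_simps)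
      then have "\<epsilon>\<^sup>2 / (2 * (s i)\<^sup>2) \<le> 1/8 + 1 / (16 * real m)" by (rule add_increasing2[rotated]) simp
      then show ?thesis using True \<open>i = k\<close> by simp
    next
      case False
      have "real d * \<epsilon> ^ 4 / (s i) ^ 4 = real d * (\<epsilon>\<^sup>2 * n)\<^sup>2 / (\<tau>\<^sup>2)\<^sup>2"
      proof -
        have "(s i) ^ 4 = ((s i)\<^sup>2)\<^sup>2" by simp
        also have "\<dots> = (\<tau>\<^sup>2)\<^sup>2 / n\<^sup>2" using i by (simp add: sn power_divide)
        finally show ?thesis by (simp add: power_mult_distrib)
      qed
      also have "\<dots> \<le> 1 / (16 * real m)"
        using i \<tau> \<epsilon>m by (simp add: field_simps)
      finally show ?thesis using False by (simp add: add_increasing)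
    qed
  qed
  moreover have "(\<Sum>i\<in>{1..m}. (if i = k then 1/8 else 0) + 1 / (16 * real m)) = 1/8 + (1/16::real)"
    using k by (simp add: sum.distrib)
  moreover have "(\<Sum>i\<in>{0..m}. ?f i) = ?f 0 + (\<Sum>i\<in>{1..m}. ?f i)"
    by (simp add: sum.atLeast_Suc_atMost)
  ultimately show ?thesis by linarith
qed

text \<open>
  The weight \<open>n\<^sub>0 + n * card {k. l k = 1}\<close> is written as a sum over the sources.  The part with factor
  \<open>n\<close> belonging to source \<open>k\<close> keeps only the label vectors with \<open>l k = 1\<close>, half of all of them, and
  these are the label vectors for the set \<open>{0, k}\<close> of known labels.
\<close>
lemma adaptation_cost_ge_hidden_labels:
  fixes n n\<^sub>0 :: nat
  assumes C: "C \<ge> 1/2" and m: "m \<ge> 1" and d: "d \<ge> 1" and n: "n \<ge> 1" "n\<^sub>0 \<ge> 1" and \<tau>: "\<tau> > 0"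
    and ns: "ns 0 = n\<^sub>0" "\<And>k. k \<in> {1..m} \<Longrightarrow> ns k = n"
    and est: "est \<in> measurable (obs_space d m) (vec_space d)"
    and \<epsilon>d: "4 * real d * \<epsilon>\<^sup>2 \<le> 1"
    and \<epsilon>0: "\<epsilon>\<^sup>2 * real n\<^sub>0 \<le> \<tau>\<^sup>2 / 4" and \<epsilon>1: "\<epsilon>\<^sup>2 * real n \<le> \<tau>\<^sup>2 / 4"
    and \<epsilon>m: "real d * real m * (\<epsilon>\<^sup>2 * real n)\<^sup>2 \<le> (\<tau>\<^sup>2)\<^sup>2 / 16"
  shows "ennreal ((real n\<^sub>0 + real m * real n) * \<epsilon>\<^sup>2 / (16 * \<tau>\<^sup>2))
    \<le> adaptation_cost C d m ns \<tau> est ({1..m} \<rightarrow>\<^sub>E {0..1})"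
proof -
  define s where "s k = \<tau> / sqrt (real (if k = 0 then n\<^sub>0 else n))" for k :: nat
  have s_pos: "s k > 0" for k using \<tau> n by (simp add: s_def)
  have s_ns: "real (ns k) * (s k)\<^sup>2 = \<tau>\<^sup>2" if "k \<le> m" for k
    using that ns(1) ns(2)[of k] n by (cases "k = 0") (simp_all add: s_def power_divide)
  let ?K = "adaptation_cost C d m ns \<tau> est ({1..m} \<rightarrow>\<^sub>E {0..1})"
  let ?H = "hypercube d \<epsilon>" and ?L = "sign_labels m {0}"
  let ?cH = "real (card ?H)" and ?cL = "real (card ?L)"
  let ?r = "\<lambda>v l. sq_risk d est (gauss_law d m s (sign_params d m v l)) (sign_params d m v l)"
  have small: "(\<Sum>i\<in>{0..m}. if i \<in> F then \<epsilon>\<^sup>2 / (2 * (s i)\<^sup>2) else real d * \<epsilon> ^ 4 / (s i) ^ 4) \<le> 1/2"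
    if "k \<in> {1..m}" "0 \<in> F" "F \<subseteq> {0, k}" for k F
    by (rule affinity_deficits_le_half[OF that \<tau> _ _ _ \<epsilon>0 \<epsilon>1 \<epsilon>m]) (use n in \<open>auto simp: s_def\<close>)
  have each: "ennreal (real n\<^sub>0) * ?r v l + (\<Sum>k\<in>{1..m}. ennreal (real n) * (if l k = 1 then ?r v l else 0))
      \<le> ennreal (real d * \<tau>\<^sup>2) * ?K" if v: "v \<in> ?H" and l: "l \<in> ?L" for v l
  proof -
    let ?S = "{k \<in> {1..m}. l k = 1}"
    have l0: "l 0 = 1" using l by (force simp: sign_labels_def PiE_def Pi_def)
    have lk: "l k = 1 \<or> l k = - 1" if "k \<in> {1..m}" for k
      using l that by (force simp: sign_labels_def PiE_def Pi_def)
    have "ennreal (real (ns 0) + (\<Sum>k\<in>?S. real (ns k))) * ?r v l \<le> ennreal (real d * \<tau>\<^sup>2) * ?K"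
    proof (rule adaptation_cost_ge_clean_risk[OF C s_pos s_ns d \<tau>])
      show "sign_params d m v l \<in> space (obs_space d m)"
        by (auto simp: sign_params_def obs_space_def vec_space_def space_PiM)
      show "L2_set (\<lambda>j. sign_params d m v l k j - sign_params d m v l 0 j) {..<d} \<le> 1" if k: "k \<in> {1..m}" for k
      proof -
        have "(\<Sum>j<d. (sign_params d m v l k j - sign_params d m v l 0 j)\<^sup>2) \<le> (\<Sum>j<d. 4 * \<epsilon>\<^sup>2)"
        proof (rule sum_mono)
          fix j assume j: "j \<in> {..<d}"
          have "sign_params d m v l k j - sign_params d m v l 0 j = (l k - 1) * v j"
            using j k l0 by (simp add: sign_params_def algebra_simps)
          moreover have "(l k - 1)\<^sup>2 \<le> 4" using lk[OF k] by auto
          ultimately show "(sign_params d m v l k j - sign_params d m v l 0 j)\<^sup>2 \<le> 4 * \<epsilon>\<^sup>2"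
            using hypercube_sq[OF v, of j] j by (simp add: power_mult_distrib mult_right_mono)
        qed
        also have "\<dots> \<le> 1" using \<epsilon>d by (simp add: mult.commute mult.left_commute)
        finally show ?thesis by (simp add: L2_set_def)
      qed
      show "sign_params d m v l k = sign_params d m v l 0" if "k \<in> ?S" for k
        using that l0 by (auto simp: sign_params_def)
    qed auto
    moreover have "ennreal (real (ns 0) + (\<Sum>k\<in>?S. real (ns k))) * ?r v l
        = ennreal (real n\<^sub>0) * ?r v l + (\<Sum>k\<in>{1..m}. ennreal (real n) * (if l k = 1 then ?r v l else 0))"
    proof -
      have "(\<Sum>k\<in>?S. real (ns k)) = (\<Sum>k\<in>{1..m}. if l k = 1 then real n else 0)"
        using ns(2) by (subst sum.inter_filter[symmetric]) (auto intro!: sum.cong)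
      then have "ennreal (real (ns 0) + (\<Sum>k\<in>?S. real (ns k)))
          = ennreal (real n\<^sub>0) + ennreal (\<Sum>k\<in>{1..m}. if l k = 1 then real n else 0)"
        by (simp only: ns(1)) (intro ennreal_plus sum_nonneg; simp)
      also have "ennreal (\<Sum>k\<in>{1..m}. if l k = 1 then real n else 0)
          = (\<Sum>k\<in>{1..m}. ennreal (if l k = 1 then real n else 0))"
        by (intro sum_ennreal[symmetric]) simp
      finally show ?thesis
        by (simp only: distrib_right sum_distrib_right) (intro arg_cong2[where f = "(+)"] sum.cong refl; simp)
    qed
    ultimately show ?thesis by simp
  qed
  have half: "ennreal (?cH * ?cL * (real d * \<epsilon>\<^sup>2 / 16)) \<le> (\<Sum>v\<in>?H. \<Sum>l\<in>?L. if l k = 1 then ?r v l else 0)"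
    if k: "k \<in> {1..m}" for k
  proof -
    have eq: "?cH * ?cL * (real d * \<epsilon>\<^sup>2 / 16) = ?cH * real (card (sign_labels m {0, k})) * (real d * \<epsilon>\<^sup>2 / 8)"
      using arg_cong[OF sign_labels_fixed_coordinate(2)[OF k], of real] by (simp add: field_simps)
    have "ennreal (?cH * ?cL * (real d * \<epsilon>\<^sup>2 / 16)) \<le> (\<Sum>v\<in>?H. \<Sum>l\<in>sign_labels m {0, k}. ?r v l)"
      unfolding eq by (rule assouad_sign_mixture[OF s_pos est _ small[OF k]]) auto
    also have "\<dots> = (\<Sum>v\<in>?H. \<Sum>l\<in>?L. if l k = 1 then ?r v l else 0)"
      unfolding sign_labels_fixed_coordinate(1)[OF k]
      by (intro sum.cong refl sum.inter_filter finite_sign_labels)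
    finally show ?thesis .
  qed
  \<comment> \<open>Discarding labels is affordable for the part with factor \<open>n\<^sub>0\<close> as well.\<close>
  have whole: "ennreal (?cH * ?cL * (real d * \<epsilon>\<^sup>2 / 16)) \<le> (\<Sum>v\<in>?H. \<Sum>l\<in>?L. ?r v l)"
    by (rule order_trans[OF half[of 1]]) (use m in \<open>auto intro!: sum_mono\<close>)
  have weights: "ennreal ((real n\<^sub>0 + real m * real n) * q)
      = ennreal (real n\<^sub>0) * ennreal q + (\<Sum>k\<in>{1..m}. ennreal (real n) * ennreal q)" if q: "q \<ge> 0" for q
  proof -
    have "(\<Sum>k\<in>{1..m}. ennreal (real n) * ennreal q) = ennreal (\<Sum>k\<in>{1..m}. real n * q)"
      using q by (subst sum_ennreal[symmetric]) (simp_all add: ennreal_mult)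
    moreover have "(real n\<^sub>0 + real m * real n) * q = real n\<^sub>0 * q + (\<Sum>k\<in>{1..m}. real n * q)"
      by (simp add: algebra_simps)
    moreover have "ennreal (real n\<^sub>0 * q + (\<Sum>k\<in>{1..m}. real n * q))
        = ennreal (real n\<^sub>0) * ennreal q + ennreal (\<Sum>k\<in>{1..m}. real n * q)"
      using q by (subst ennreal_plus) (auto simp: ennreal_mult intro!: sum_nonneg)
    ultimately show ?thesis by simp
  qed
  have "ennreal ((real n\<^sub>0 + real m * real n) * (?cH * ?cL * (real d * \<epsilon>\<^sup>2 / 16)))
      = ennreal (real n\<^sub>0) * ennreal (?cH * ?cL * (real d * \<epsilon>\<^sup>2 / 16))
        + (\<Sum>k\<in>{1..m}. ennreal (real n) * ennreal (?cH * ?cL * (real d * \<epsilon>\<^sup>2 / 16)))"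
    by (rule weights) simp
  also have "\<dots> \<le> ennreal (real n\<^sub>0) * (\<Sum>v\<in>?H. \<Sum>l\<in>?L. ?r v l)
      + (\<Sum>k\<in>{1..m}. ennreal (real n) * (\<Sum>v\<in>?H. \<Sum>l\<in>?L. if l k = 1 then ?r v l else 0))"
    by (intro add_mono mult_left_mono sum_mono whole half) auto
  also have "(\<Sum>k\<in>{1..m}. ennreal (real n) * (\<Sum>v\<in>?H. \<Sum>l\<in>?L. if l k = 1 then ?r v l else 0))
      = (\<Sum>v\<in>?H. \<Sum>k\<in>{1..m}. \<Sum>l\<in>?L. ennreal (real n) * (if l k = 1 then ?r v l else 0))"
    unfolding sum_distrib_left by (rule sum.swap)
  also have "\<dots> = (\<Sum>v\<in>?H. \<Sum>l\<in>?L. \<Sum>k\<in>{1..m}. ennreal (real n) * (if l k = 1 then ?r v l else 0))"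
    by (intro sum.cong refl sum.swap)
  also have "ennreal (real n\<^sub>0) * (\<Sum>v\<in>?H. \<Sum>l\<in>?L. ?r v l) + \<dots>
      = (\<Sum>v\<in>?H. \<Sum>l\<in>?L. ennreal (real n\<^sub>0) * ?r v l
          + (\<Sum>k\<in>{1..m}. ennreal (real n) * (if l k = 1 then ?r v l else 0)))"
    by (simp only: sum.distrib sum_distrib_left)
  also have "\<dots> \<le> (\<Sum>v\<in>?H. \<Sum>l\<in>?L. ennreal (real d * \<tau>\<^sup>2) * ?K)"
    by (intro sum_mono each)
  also have "\<dots> = ennreal (?cH * ?cL * (real d * \<tau>\<^sup>2)) * ?K"
    by (simp add: ennreal_mult ennreal_of_nat_eq_real_of_nat mult.assoc)
  finally have le: "ennreal ((real n\<^sub>0 + real m * real n) * (?cH * ?cL * (real d * \<epsilon>\<^sup>2 / 16)))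
      \<le> ennreal (?cH * ?cL * (real d * \<tau>\<^sup>2)) * ?K" .
  have "?H \<noteq> {}" "?L \<noteq> {}" by (auto simp: hypercube_def sign_labels_def PiE_eq_empty_iff)
  then have pos: "?cH > 0" "?cL > 0" using finite_hypercube finite_sign_labels by (simp_all add: card_gt_0_iff)
  have "ennreal ((real n\<^sub>0 + real m * real n) * (?cH * ?cL * (real d * \<epsilon>\<^sup>2 / 16)) / (?cH * ?cL * (real d * \<tau>\<^sup>2))) \<le> ?K"
    by (rule ennreal_divide_le_of_le_mult[OF _ le]) (use pos d \<tau> in simp)
  moreover have "(real n\<^sub>0 + real m * real n) * (?cH * ?cL * (real d * \<epsilon>\<^sup>2 / 16)) / (?cH * ?cL * (real d * \<tau>\<^sup>2))
      = (real n\<^sub>0 + real m * real n) * \<epsilon>\<^sup>2 / (16 * \<tau>\<^sup>2)"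
    using pos d by (simp add: divide_simps)
  ultimately show ?thesis by simp
qed

section \<open>Two clusters of sources\<close>

definition axis_params :: "nat \<Rightarrow> nat \<Rightarrow> (nat \<Rightarrow> real) \<Rightarrow> nat \<Rightarrow> nat \<Rightarrow> real" where
  "axis_params d m c = (\<lambda>k\<in>{0..m}. \<lambda>j\<in>{..<d}. if j = 0 then c k else 0)"

lemma axis_params_in_space: "axis_params d m c \<in> space (obs_space d m)"
  by (auto simp: axis_params_def obs_space_def vec_space_def space_PiM)

lemma axis_params_dist:
  assumes "k \<in> {1..m}"
  shows "L2_set (\<lambda>j. axis_params d m c k j - axis_params d m c 0 j) {..<d} \<le> \<bar>c k - c 0\<bar>"
proof -
  have "L2_set (\<lambda>j. axis_params d m c k j - axis_params d m c 0 j) {..<d}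
      = L2_set (\<lambda>j. if j = 0 then c k - c 0 else 0) {..<d}"
    using assms by (intro L2_set_cong) (auto simp: axis_params_def)
  also have "\<dots> \<le> \<bar>c k - c 0\<bar>"
    unfolding L2_set_def by (rule real_le_lsqrt) (auto simp: sum_nonneg if_distrib[where f = "\<lambda>x. x\<^sup>2"] cong: if_cong)
  finally show ?thesis .
qed

text \<open>
  Changing the sign of \<open>c 0\<close> moves the target and leaves the laws of all sources as they are, so the
  only affinity below \<open>1\<close> is that of the target.
\<close>
lemma two_target_risk:
  assumes s: "\<And>k. s k > 0" and est: "est \<in> measurable (obs_space d m) (vec_space d)" and d: "d \<ge> 1"
    and \<epsilon>: "(c 0)\<^sup>2 \<le> (s 0)\<^sup>2"
  defines "c' \<equiv> c(0 := - c 0)"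
  shows "ennreal ((c 0)\<^sup>2 / 4) \<le>
    sq_risk d est (gauss_law d m s (axis_params d m c)) (axis_params d m c)
    + sq_risk d est (gauss_law d m s (axis_params d m c')) (axis_params d m c')"
proof -
  let ?L = "PiM {0..m} (\<lambda>_. lebesgue_vec d)"
  let ?p = "\<lambda>c k. normal_vec_density d (s k) (axis_params d m c k)"
  let ?\<delta> = "\<lambda>k. if k = 0 then (c 0)\<^sup>2 / (2 * (s 0)\<^sup>2) else 0"
  have e0: "(\<lambda>\<omega>. est \<omega> 0) \<in> borel_measurable (obs_space d m)"
    using estimator_component_measurable[OF est] d by simp
  then have e: "(\<lambda>\<omega>. est \<omega> 0) \<in> borel_measurable ?L"
    by (simp add: measurable_cong_sets[OF sets_obs_space refl])
  note [measurable] = e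
  have risk: "(\<integral>\<^sup>+\<omega>. ennreal ((est \<omega> 0 - c 0)\<^sup>2) * ennreal (\<Prod>k\<in>{0..m}. ?p c k (\<omega> k)) \<partial>?L)
      \<le> sq_risk d est (gauss_law d m s (axis_params d m c)) (axis_params d m c)" for c
  proof -
    have meas: "(\<lambda>\<omega>. ennreal (\<Prod>k\<in>{0..m}. ?p c k (\<omega> k))) \<in> borel_measurable ?L" by measurable
    have "(\<integral>\<^sup>+\<omega>. ennreal ((est \<omega> 0 - c 0)\<^sup>2) * ennreal (\<Prod>k\<in>{0..m}. ?p c k (\<omega> k)) \<partial>?L)
        = (\<integral>\<^sup>+\<omega>. ennreal ((est \<omega> 0 - c 0)\<^sup>2) \<partial>gauss_law d m s (axis_params d m c))"
      unfolding gauss_law_eq_density[OF s] using meas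
      by (subst nn_integral_density) (auto simp: mult.commute)
    also have "\<dots> \<le> sq_risk d est (gauss_law d m s (axis_params d m c)) (axis_params d m c)"
      unfolding sq_risk_def
    proof (intro nn_integral_mono ennreal_leI)
      fix \<omega>
      let ?x = "\<lambda>j. est \<omega> j - axis_params d m c 0 j"
      have "(est \<omega> 0 - c 0)\<^sup>2 = (\<Sum>j\<in>{0}. (?x j)\<^sup>2)" using d by (simp add: axis_params_def)
      also have "\<dots> \<le> (\<Sum>j<d. (?x j)\<^sup>2)" using d by (intro sum_mono2) auto
      finally show "(est \<omega> 0 - c 0)\<^sup>2 \<le> (L2_set ?x {..<d})\<^sup>2" by (simp add: L2_set_def sum_nonneg)
    qed
    finally show ?thesis .
  qed
  have "ennreal ((c 0)\<^sup>2 / 4) \<le>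
    (\<integral>\<^sup>+\<omega>. ennreal ((est \<omega> 0 - c 0)\<^sup>2) * ennreal (\<Prod>k\<in>{0..m}. ?p c k (\<omega> k)) \<partial>?L)
    + (\<integral>\<^sup>+\<omega>. ennreal ((est \<omega> 0 + c 0)\<^sup>2) * ennreal (\<Prod>k\<in>{0..m}. ?p c' k (\<omega> k)) \<partial>?L)"
  proof (rule two_point_risk[where \<delta> = ?\<delta>])
    show "ennreal (1 - ?\<delta> k) \<le> (\<integral>\<^sup>+x. ennreal (sqrt (?p c k x * ?p c' k x)) \<partial>lebesgue_vec d)"
      if "k \<in> {0..m}" for k
    proof (cases "k = 0")
      case True
      let ?v = "axis_params d m c 0"
      have v0: "?v 0 = c 0" using d by (simp add: axis_params_def)
      have flip: "axis_params d m c' 0 = ?v(0 := - ?v 0)"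
        using d by (auto simp: axis_params_def c'_def fun_eq_iff)
      have "1 - ?\<delta> 0 \<le> exp (- ((?v 0)\<^sup>2 / (2 * (s 0)\<^sup>2)))"
        using exp_ge_add_one_self[of "- ((c 0)\<^sup>2 / (2 * (s 0)\<^sup>2))"] by (simp add: v0)
      then show ?thesis
        using affinity_normal_vec_flip[OF s[of 0], of 0 d ?v] d unfolding True flip
        by (simp add: ennreal_leI)
    next
      case False
      then have "axis_params d m c' k = axis_params d m c k" by (auto simp: axis_params_def c'_def fun_eq_iff)
      then show ?thesis
        using False by (simp add: normal_vec_density_nonneg nn_integral_normal_vec_density[OF s])
    qed
    show "sum ?\<delta> {0..m} \<le> 1/2" using \<epsilon> s[of 0] by (simp add: field_simps)
    show "(\<lambda>\<omega>. est \<omega> 0) \<in> borel_measurable ?L" by (rule e)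
  qed (simp_all add: sigma_finite_lebesgue_vec normal_vec_density_nonneg nn_integral_normal_vec_density[OF s])
  also have "\<dots> \<le> sq_risk d est (gauss_law d m s (axis_params d m c)) (axis_params d m c)
    + sq_risk d est (gauss_law d m s (axis_params d m c')) (axis_params d m c')"
    using risk[of c] risk[of c'] by (intro add_mono) (simp_all add: c'_def)
  finally show ?thesis .
qed

text \<open>
  Each of the two clusters has at least \<open>m / 3\<close> sources as \<open>m \<ge> 2\<close>; the extreme case is \<open>m = 3\<close>.
\<close>
lemma adaptation_cost_ge_ambiguous_cluster:
  fixes n n\<^sub>0 :: nat
  assumes C: "C \<ge> 1/2" and m: "m \<ge> 2" and d: "d \<ge> 1" and n: "n \<ge> 1" "n\<^sub>0 \<ge> 1" and \<tau>: "\<tau> > 0"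
    and ns: "ns 0 = n\<^sub>0" "\<And>k. k \<in> {1..m} \<Longrightarrow> ns k = n"
    and est: "est \<in> measurable (obs_space d m) (vec_space d)"
    and \<tau>1: "\<tau>\<^sup>2 \<le> real n\<^sub>0"
  shows "ennreal ((real n\<^sub>0 + real m * real n) / (96 * real d * real n\<^sub>0))
    \<le> adaptation_cost C d m ns \<tau> est ({1..m} \<rightarrow>\<^sub>E {0..1})"
proof -
  define s where "s k = \<tau> / sqrt (real (if k = 0 then n\<^sub>0 else n))" for k :: nat
  have s_pos: "s k > 0" for k using \<tau> n by (simp add: s_def)
  have s_ns: "real (ns k) * (s k)\<^sup>2 = \<tau>\<^sup>2" if "k \<le> m" for k
    using that ns(1) ns(2)[of k] n by (cases "k = 0") (simp_all add: s_def power_divide)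
  let ?K = "adaptation_cost C d m ns \<tau> est ({1..m} \<rightarrow>\<^sub>E {0..1})"
  define \<epsilon> where "\<epsilon> = s 0 / 2"
  have \<epsilon>: "\<epsilon> > 0" "\<epsilon> \<le> 1/2" and \<epsilon>sq: "\<epsilon>\<^sup>2 = \<tau>\<^sup>2 / (4 * real n\<^sub>0)"
  proof -
    have "s 0 \<le> 1" using \<tau> \<tau>1 n by (simp add: s_def real_le_rsqrt)
    then show "\<epsilon> > 0" "\<epsilon> \<le> 1/2" using s_pos[of 0] by (simp_all add: \<epsilon>_def)
    show "\<epsilon>\<^sup>2 = \<tau>\<^sup>2 / (4 * real n\<^sub>0)" using n by (simp add: \<epsilon>_def s_def power_divide)
  qed
  define c where "c k = (if k \<le> m div 2 then \<epsilon> else - \<epsilon>)" for k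
  let ?c' = "c(0 := - c 0)"
  let ?r = "\<lambda>c. sq_risk d est (gauss_law d m s (axis_params d m c)) (axis_params d m c)"
  let ?N = "real n\<^sub>0 + real m * real n / 3"
  have clean: "ennreal ?N * ?r b \<le> ennreal (real d * \<tau>\<^sup>2) * ?K"
    if S: "S \<subseteq> {1..m}" "m \<le> 3 * card S" and b: "\<And>k. k \<in> S \<Longrightarrow> b k = b 0" "\<And>k. \<bar>b k\<bar> \<le> \<epsilon>" for S b
  proof -
    have "real m \<le> 3 * real (card S)" using S(2) by linarith
    then have "real m * real n / 3 \<le> real (card S) * real n"
      using mult_right_mono[of "real m" "3 * real (card S)" "real n"] by simp
    also have "\<dots> = (\<Sum>k\<in>S. real (ns k))" using ns(2) S(1) by (simp add: subset_eq)
    finally have "ennreal ?N * ?r b \<le> ennreal (real (ns 0) + (\<Sum>k\<in>S. real (ns k))) * ?r b"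
      using ns(1) by (intro mult_right_mono ennreal_leI) auto
    also have "\<dots> \<le> ennreal (real d * \<tau>\<^sup>2) * ?K"
    proof (rule adaptation_cost_ge_clean_risk[OF C s_pos s_ns d \<tau> axis_params_in_space _ S(1)])
      show "L2_set (\<lambda>j. axis_params d m b k j - axis_params d m b 0 j) {..<d} \<le> 1" if "k \<in> {1..m}" for k
        using axis_params_dist[OF that, of d b] b(2)[of k] b(2)[of 0] \<epsilon> by linarith
      show "axis_params d m b k = axis_params d m b 0" if "k \<in> S" for k
        using that S(1) b(1)[OF that] by (auto simp: axis_params_def fun_eq_iff)
    qed
    finally show ?thesis .
  qed
  have abs_c: "\<bar>c k\<bar> \<le> \<epsilon>" "\<bar>?c' k\<bar> \<le> \<epsilon>" for k using \<epsilon> by (auto simp: c_def)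
  have c: "ennreal ?N * ?r c \<le> ennreal (real d * \<tau>\<^sup>2) * ?K"
  proof (rule clean[of "{1..m div 2}"])
    show "m \<le> 3 * card {1..m div 2}" using m by simp
  qed (use abs_c in \<open>auto simp: c_def\<close>)
  have c': "ennreal ?N * ?r ?c' \<le> ennreal (real d * \<tau>\<^sup>2) * ?K"
  proof (rule clean[of "{m div 2 + 1..m}"])
    show "m \<le> 3 * card {m div 2 + 1..m}" using m by simp
  qed (use abs_c in \<open>auto simp: c_def\<close>)
  have c0: "(c 0)\<^sup>2 = \<tau>\<^sup>2 / (4 * real n\<^sub>0)" by (simp add: c_def \<epsilon>sq)
  have "(c 0)\<^sup>2 \<le> (s 0)\<^sup>2" using s_pos[of 0] by (simp add: c_def \<epsilon>_def power_divide)
  then have "ennreal ?N * ennreal ((c 0)\<^sup>2 / 4) \<le> ennreal ?N * (?r c + ?r ?c')"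
    by (intro mult_left_mono two_target_risk[OF s_pos est d]) auto
  also have "\<dots> \<le> ennreal (real d * \<tau>\<^sup>2) * ?K + ennreal (real d * \<tau>\<^sup>2) * ?K"
    unfolding distrib_left using c c' by (rule add_mono)
  also have "\<dots> = ennreal (real d * \<tau>\<^sup>2 + real d * \<tau>\<^sup>2) * ?K"
    by (subst ennreal_plus) (simp_all only: distrib_right mult_nonneg_nonneg of_nat_0_le_iff zero_le_power2)
  finally have "ennreal (?N * ((c 0)\<^sup>2 / 4)) \<le> ennreal (2 * (real d * \<tau>\<^sup>2)) * ?K"
    unfolding mult_2 by (subst ennreal_mult) simp_all
  then have le: "ennreal (?N * ((c 0)\<^sup>2 / 4) / (2 * (real d * \<tau>\<^sup>2))) \<le> ?K"
    by (rule ennreal_divide_le_of_le_mult[rotated]) (use d \<tau> in simp)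
  have "(real n\<^sub>0 + real m * real n) / (96 * real d * real n\<^sub>0) \<le> ?N * ((c 0)\<^sup>2 / 4) / (2 * (real d * \<tau>\<^sup>2))"
  proof -
    have "?N * ((c 0)\<^sup>2 / 4) / (2 * (real d * \<tau>\<^sup>2)) = (3 * real n\<^sub>0 + real m * real n) / (96 * real d * real n\<^sub>0)"
      unfolding c0 using n d \<tau> by (simp add: field_simps)
    then show ?thesis by (simp add: divide_right_mono)
  qed
  from ennreal_leI[OF this] le show ?thesis by (rule order_trans)
qed

section \<open>The lower bound\<close>

text \<open>
  The constraint \<open>d * \<tau>\<^sup>2 \<le> n\<^sub>0\<close> ensures that the biases of the two constructions do not exceed \<open>1\<close>.  The
  constructions give the constants \<open>1/64\<close> and \<open>1/96\<close>.
\<close>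
theorem theorem8:
  shows "\<exists>c\<^sub>L>0::real.
    \<forall>(C\<^sub>\<tau>::real) (m::nat) (d::nat) (n::nat) (n\<^sub>0::nat) (ns::nat \<Rightarrow> nat) (\<tau>::real).
      C\<^sub>\<tau> \<ge> 1 / 2 \<longrightarrow> m \<ge> 2 \<longrightarrow> d \<ge> 1 \<longrightarrow> n \<ge> 1 \<longrightarrow> n\<^sub>0 \<ge> 1 \<longrightarrow> \<tau> > 0 \<longrightarrow>
      ns 0 = n\<^sub>0 \<longrightarrow> (\<forall>k\<in>{1..m}. ns k = n) \<longrightarrow>
      real d * \<tau>\<^sup>2 / real n\<^sub>0 \<le> 1 \<longrightarrow>
      intrinsic_cost C\<^sub>\<tau> d m ns \<tau> ({1..m} \<rightarrow>\<^sub>E {0..1})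
        \<ge> ennreal (c\<^sub>L * max
             ((real n\<^sub>0 + real m * real n) / real d
                * min (real d / real n\<^sub>0) (1 / real n * sqrt (real d / real m)))
             ((real n\<^sub>0 + real m * real n) / (real d * real n\<^sub>0)))"
proof (intro exI[of _ "1/96"] conjI allI impI)
  fix C\<^sub>\<tau> \<tau> :: real and m d n n\<^sub>0 :: nat and ns :: "nat \<Rightarrow> nat"
  assume C: "C\<^sub>\<tau> \<ge> 1 / 2" and m: "m \<ge> 2" and d: "d \<ge> 1" and n: "n \<ge> 1" "n\<^sub>0 \<ge> 1" and \<tau>: "\<tau> > 0"
    and ns: "ns 0 = n\<^sub>0" "\<forall>k\<in>{1..m}. ns k = n" and small: "real d * \<tau>\<^sup>2 / real n\<^sub>0 \<le> 1"
  let ?N = "real n\<^sub>0 + real m * real n"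
  \<comment> \<open>\<open>\<rho>\<close> is the bound on \<open>\<epsilon>\<^sup>2 / \<tau>\<^sup>2\<close> up to a constant; \<open>d * \<rho>\<close> is the minimum in the claim.\<close>
  define \<rho> where "\<rho> = min (1 / real n\<^sub>0) (1 / (real n * sqrt (real d * real m)))"
  have \<rho>: "\<rho> \<ge> 0" "\<rho> * real n\<^sub>0 \<le> 1" "\<rho> * real n * sqrt (real d * real m) \<le> 1"
  proof -
    show "\<rho> \<ge> 0" by (simp add: \<rho>_def)
    have "\<rho> \<le> 1 / real n\<^sub>0" "\<rho> \<le> 1 / (real n * sqrt (real d * real m))" by (simp_all add: \<rho>_def)
    then show "\<rho> * real n\<^sub>0 \<le> 1" "\<rho> * real n * sqrt (real d * real m) \<le> 1"
      using n d m by (simp_all add: field_simps)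
  qed
  define \<epsilon> where "\<epsilon> = \<tau> / 2 * sqrt \<rho>"
  have \<epsilon>: "\<epsilon>\<^sup>2 = \<tau>\<^sup>2 / 4 * \<rho>" using \<rho>(1) by (simp add: \<epsilon>_def power_mult_distrib power_divide)
  have rho: "real d * \<rho> = min (real d / real n\<^sub>0) (1 / real n * sqrt (real d / real m))"
  proof -
    have "real d * (1 / (real n * sqrt (real d * real m)))
        = (real d / sqrt (real d)) / (real n * sqrt (real m))"
      by (simp add: real_sqrt_mult mult_ac)
    also have "\<dots> = 1 / real n * sqrt (real d / real m)"
      by (simp only: real_div_sqrt[OF of_nat_0_le_iff] real_sqrt_divide) simp
    finally show ?thesis using d by (simp add: \<rho>_def min_mult_distrib_left)
  qed
  have cost: "ennreal (1/96 * max (?N * \<rho>) (?N / (real d * real n\<^sub>0)))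
      \<le> adaptation_cost C\<^sub>\<tau> d m ns \<tau> est ({1..m} \<rightarrow>\<^sub>E {0..1})" (is "_ \<le> ?K")
    if est: "est \<in> measurable (obs_space d m) (vec_space d)" for est
  proof -
    have "ennreal (1/96 * (?N * \<rho>)) \<le> ennreal (1/64 * (?N * \<rho>))"
      using \<rho>(1) by (intro ennreal_leI mult_right_mono) auto
    also have "1/64 * (?N * \<rho>) = ?N * \<epsilon>\<^sup>2 / (16 * \<tau>\<^sup>2)" using \<tau> by (simp add: \<epsilon>)
    also have "ennreal (?N * \<epsilon>\<^sup>2 / (16 * \<tau>\<^sup>2)) \<le> ?K"
    proof (rule adaptation_cost_ge_hidden_labels[where ns = ns and n = n and n\<^sub>0 = n\<^sub>0, OF C _ d n \<tau> ns(1) _ est])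
      have "real d * \<tau>\<^sup>2 * \<rho> \<le> real n\<^sub>0 * \<rho>"
        using small n \<rho>(1) by (intro mult_right_mono) (simp_all add: divide_le_eq)
      then show "4 * real d * \<epsilon>\<^sup>2 \<le> 1" using \<rho>(2) by (simp add: \<epsilon> mult_ac)
      show "\<epsilon>\<^sup>2 * real n\<^sub>0 \<le> \<tau>\<^sup>2 / 4"
        using mult_left_mono[OF \<rho>(2), of "\<tau>\<^sup>2 / 4"] by (simp add: \<epsilon> mult_ac)
      have "1 \<le> real d * real m" using d m by (simp add: mult_ge1_I)
      then have "\<rho> * real n * 1 \<le> \<rho> * real n * sqrt (real d * real m)"
        using \<rho>(1) by (intro mult_left_mono) auto
      then have "\<rho> * real n \<le> 1" using \<rho>(3) by simp
      from mult_left_mono[OF this, of "\<tau>\<^sup>2 / 4"] show "\<epsilon>\<^sup>2 * real n \<le> \<tau>\<^sup>2 / 4"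
        by (simp add: \<epsilon> mult_ac)
      have "(\<rho> * real n * sqrt (real d * real m))\<^sup>2 \<le> 1"
        using \<rho> by (intro power_le_one) auto
      then have "real d * real m * (\<rho> * real n)\<^sup>2 \<le> 1" by (simp add: power_mult_distrib mult_ac)
      from mult_left_mono[OF this, of "(\<tau>\<^sup>2)\<^sup>2 / 16"]
      show "real d * real m * (\<epsilon>\<^sup>2 * real n)\<^sup>2 \<le> (\<tau>\<^sup>2)\<^sup>2 / 16"
        by (simp add: \<epsilon> power_mult_distrib power_divide mult_ac)
    qed (use m ns(2) in auto)
    finally have 1: "ennreal (1/96 * (?N * \<rho>)) \<le> ?K" .
    have "1 * \<tau>\<^sup>2 \<le> real d * \<tau>\<^sup>2" using d by (intro mult_right_mono) auto
    then have "\<tau>\<^sup>2 \<le> real n\<^sub>0" using small n by (simp add: divide_le_eq)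
    then have "ennreal (?N / (96 * real d * real n\<^sub>0)) \<le> ?K"
      using ns(2) by (intro adaptation_cost_ge_ambiguous_cluster[where ns = ns and n = n and n\<^sub>0 = n\<^sub>0, OF C m d n \<tau> ns(1) _ est]) auto
    then have 2: "ennreal (1/96 * (?N / (real d * real n\<^sub>0))) \<le> ?K" by (simp add: mult.assoc)
    show ?thesis using 1 2 by (simp only: max_def split: if_split) blast
  qed
  have "?N / real d * min (real d / real n\<^sub>0) (1 / real n * sqrt (real d / real m)) = ?N * \<rho>"
    unfolding rho[symmetric] using d by simp
  then show "ennreal (1/96 * max (?N / real d * min (real d / real n\<^sub>0) (1 / real n * sqrt (real d / real m)))
      (?N / (real d * real n\<^sub>0))) \<le> intrinsic_cost C\<^sub>\<tau> d m ns \<tau> ({1..m} \<rightarrow>\<^sub>E {0..1})"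
    unfolding intrinsic_cost_def using cost by (intro INF_greatest) simp
qed simp

end
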